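(* Let $\mathscr{C}$ and $\mathscr{D}$ be strict symmetric monoidal categories, let $F\colon\mathscr{C}\to\mathscr{D}$ be a functor, let $\ell_F$ be a symmetric lax-monoidal structure on $F$, and let $F^{\mathrm{mon}}\colon\mathbf{Mon}\,\mathscr{C}\to\mathbf{Mon}\,\mathscr{D}$ be the induced functor on categories of monoids with its induced lax-monoidal structure $\ell_F^{\mathrm{mon}}$. Suppose $F$ admits a colax-monoidal structure $c_F$ compatible with $\ell_F$ by the bialgebra axiom. Then one can define a colax-monoidal structure $c_F^{\mathrm{mon}}$ on $F^{\mathrm{mon}}$ and, moreover, the pair $(c_F^{\mathrm{mon}},\ell_F^{\mathrm{mon}})$ is compatible by the bialgebra axiom.
   Context: A colax-monoidal structure on a functor $F\colon\mathscr{M}_1\to\mathscr{M}_2$ between strict monoidal categories is a map of bifunctors $c_{X,Y}\colon F(X\otimes Y)\to F(X)\otimes F(Y)$ and a morphism $\alpha\colon F(1_{\mathscr{M}_1})\to 1_{\mathscr{M}_2}$ such that $(c_{X,Y}\otimes\mathrm{id})\circ c_{X\otimes Y,Z}=(\mathrm{id}\otimes c_{Y,Z})\circ c_{X,Y\otimes Z}$ for all $X,Y,Z$, and $(\alpha\otimes\mathrm{id})\circ c_{1,X}=\mathrm{id}_{F(X)}=(\mathrm{id}\otimes\alpha)\circ c_{X,1}$ for all $X$. A lax-monoidal structure is the dual notion: a map of bifunctors $\ell_{X,Y}\colon F(X)\otimes F(Y)\to F(X\otimes Y)$ and a morphism $\kappa\colon1_{\mathscr{M}_2}\to F(1_{\mathscr{M}_1})$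 with $\ell_{X\otimes Y,Z}\circ(\ell_{X,Y}\otimes\mathrm{id})=\ell_{X,Y\otimes Z}\circ(\mathrm{id}\otimes\ell_{Y,Z})$ and $\ell_{1,X}\circ(\kappa\otimes\mathrm{id})=\mathrm{id}_{F(X)}=\ell_{X,1}\circ(\mathrm{id}\otimes\kappa)$. A lax-monoidal structure $\ell$ on a functor between symmetric monoidal categories (symmetries $\sigma$) is symmetric if $F(\sigma_{X,Y})\circ\ell_{X,Y}=\ell_{Y,X}\circ\sigma_{F(X),F(Y)}$ for all $X,Y$. Bialgebra axiom: let $F\colon\mathscr{C}\to\mathscr{D}$ be a functor between strict symmetric monoidal categories with a colax-monoidal structure $c_F$ and a lax-monoidal structure $\ell_F$. The pair $(c_F,\ell_F)$ satisfies (is compatible by) the bialgebra axiom if for all objects $X,Y,Z,W$ of $\mathscr{C}$ the following two morphisms $F(X\otimes Y)\otimes F(Z\otimes W)\to F(X\otimes Z)\otimes F(Y\otimes W)$ coincide: $$F(X\otimes Y)\otimes F(Z\otimes W)\xrightarrow{\ell_F}F(X\otimes Y\otimes Z\otimes W)\xrightarrow{F(\mathrm{id}\otimes\sigma\otimes\mathrm{id})}F(X\otimes Z\otimes Y\otimes W)\xrightarrow{c_F}F(X\otimes Z)\otimes F(Y\otimes W)$$ and $$F(X\otimes Y)\otimes F(Z\otimes W)\xrightarrow{c_F\otimes c_F}F(X)\otimes F(Y)\otimes F(Z)\otimes F(W)\xrightarrow{\mathrm{id}\otimes\sigma\otimes\mathrm{id}}F(X)\otimes F(Z)\otimes F(Y)\otimes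 F(W)\xrightarrow{\ell_F\otimes\ell_F}F(X\otimes Z)\otimes F(Y\otimes W).$$ For a strict symmetric monoidal category $\mathscr{C}$, $\mathbf{Mon}\,\mathscr{C}$ is the category of strictly associative monoids with unit in $\mathscr{C}$; it is again symmetric monoidal (tensor product of monoids, with product on $A\otimes B$ formed using $\sigma$). The functor $F^{\mathrm{mon}}$ sends a monoid $(A,m,u)$ to $F(A)$ with product $F(A)\otimes F(A)\xrightarrow{\ell_F}F(A\otimes A)\xrightarrow{F(m)}F(A)$ and unit $1_{\mathscr{D}}\xrightarrow{\kappa}F(1_{\mathscr{C}})\xrightarrow{F(u)}F(A)$; the lax-monoidal structure $\ell_F^{\mathrm{mon}}$ on $F^{\mathrm{mon}}$ has as underlying maps those of $\ell_F$.
   Formalization: The formal statement also assumes the unit part of the bialgebra axiom: c_{1,1}∘κ = κ⊗κ, α∘ℓ_{1,1} = α⊗α, α∘κ = id. Without it the claim fails, e.g. for the constant functor at the zero object of matrices over a field, where no α^mon exists. *)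

theory Defs
  imports Main
begin

section \<open>Strict symmetric monoidal categories\<close>

record ('o, 'a) cat =
  Ob :: "'o set"
  Ar :: "'a set"
  Dom :: "'a \<Rightarrow> 'o"
  Cod :: "'a \<Rightarrow> 'o"
  Ide :: "'o \<Rightarrow> 'a"
  Cmp :: "'a \<Rightarrow> 'a \<Rightarrow> 'a" (infixr "\<cdot>\<index>" 65)

record ('o, 'a) mon_cat = "('o, 'a) cat" +
  TenO :: "'o \<Rightarrow> 'o \<Rightarrow> 'o" (infixr "\<odot>\<index>" 75)
  TenA :: "'a \<Rightarrow> 'a \<Rightarrow> 'a" (infixr "\<otimes>\<index>" 75)
  Unit :: 'o ("\<one>\<index>")

record ('o, 'a) sym_mon_cat = "('o, 'a) mon_cat" +
  Sym :: "'o \<Rightarrow> 'o \<Rightarrow> 'a" ("\<sigma>\<index>")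

definition Hom :: "('o, 'a, 'm) cat_scheme \<Rightarrow> 'o \<Rightarrow> 'o \<Rightarrow> 'a set" where
  "Hom C X Y = {f \<in> Ar C. Dom C f = X \<and> Cod C f = Y}"

locale category =
  fixes C (structure)
  assumes Dom_Ob: "f \<in> Ar C \<Longrightarrow> Dom C f \<in> Ob C"
    and Cod_Ob: "f \<in> Ar C \<Longrightarrow> Cod C f \<in> Ob C"
    and Ide_Hom: "X \<in> Ob C \<Longrightarrow> Ide C X \<in> Hom C X X"
    and Cmp_Hom: "f \<in> Hom C X Y \<Longrightarrow> g \<in> Hom C Y Z \<Longrightarrow> g \<cdot> f \<in> Hom C X Z"
    and Cmp_Ide: "f \<in> Hom C X Y \<Longrightarrow> f \<cdot> Ide C X = f"
    and Ide_Cmp: "f \<in> Hom C X Y \<Longrightarrow> Ide C Y \<cdot> f = f"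
    and Cmp_assoc: "f \<in> Hom C W X \<Longrightarrow> g \<in> Hom C X Y \<Longrightarrow> h \<in> Hom C Y Z \<Longrightarrow>
      (h \<cdot> g) \<cdot> f = h \<cdot> (g \<cdot> f)"

locale strict_monoidal_category = category C for C (structure) +
  assumes TenO_Ob: "X \<in> Ob C \<Longrightarrow> Y \<in> Ob C \<Longrightarrow> X \<odot> Y \<in> Ob C"
    and Unit_Ob: "\<one> \<in> Ob C"
    and TenA_Hom: "f \<in> Hom C X X' \<Longrightarrow> g \<in> Hom C Y Y' \<Longrightarrow>
      f \<otimes> g \<in> Hom C (X \<odot> Y) (X' \<odot> Y')"
    and TenA_Ide: "X \<in> Ob C \<Longrightarrow> Y \<in> Ob C \<Longrightarrow> Ide C X \<otimes> Ide C Y = Ide C (X \<odot> Y)"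
    and TenA_Cmp: "f \<in> Hom C X X' \<Longrightarrow> f' \<in> Hom C X' X'' \<Longrightarrow>
      g \<in> Hom C Y Y' \<Longrightarrow> g' \<in> Hom C Y' Y'' \<Longrightarrow>
      (f' \<cdot> f) \<otimes> (g' \<cdot> g) = (f' \<otimes> g') \<cdot> (f \<otimes> g)"
    and TenO_assoc: "X \<in> Ob C \<Longrightarrow> Y \<in> Ob C \<Longrightarrow> Z \<in> Ob C \<Longrightarrow>
      (X \<odot> Y) \<odot> Z = X \<odot> (Y \<odot> Z)"
    and TenA_assoc: "f \<in> Ar C \<Longrightarrow> g \<in> Ar C \<Longrightarrow> h \<in> Ar C \<Longrightarrow>
      (f \<otimes> g) \<otimes> h = f \<otimes> (g \<otimes> h)"
    and Unit_TenO: "X \<in> Ob C \<Longrightarrow> \<one> \<odot> X = X"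
    and TenO_Unit: "X \<in> Ob C \<Longrightarrow> X \<odot> \<one> = X"
    and Unit_TenA: "f \<in> Ar C \<Longrightarrow> Ide C \<one> \<otimes> f = f"
    and TenA_Unit: "f \<in> Ar C \<Longrightarrow> f \<otimes> Ide C \<one> = f"

text \<open>Only the associativity and unit isomorphisms are identities; the symmetry is arbitrary.
  The hexagon for the other variable and \<open>\<sigma> X \<one> = Ide X = \<sigma> \<one> X\<close> follow from the
  axioms below.\<close>

locale strict_symmetric_monoidal_category = strict_monoidal_category C for C (structure) +
  assumes Sym_Hom: "X \<in> Ob C \<Longrightarrow> Y \<in> Ob C \<Longrightarrow> \<sigma> X Y \<in> Hom C (X \<odot> Y) (Y \<odot> X)"
    and Sym_natural: "f \<in> Hom C X X' \<Longrightarrow> g \<in> Hom C Y Y' \<Longrightarrow>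
      \<sigma> X' Y' \<cdot> (f \<otimes> g) = (g \<otimes> f) \<cdot> \<sigma> X Y"
    and Sym_inverse: "X \<in> Ob C \<Longrightarrow> Y \<in> Ob C \<Longrightarrow> \<sigma> Y X \<cdot> \<sigma> X Y = Ide C (X \<odot> Y)"
    and Sym_hexagon: "X \<in> Ob C \<Longrightarrow> Y \<in> Ob C \<Longrightarrow> Z \<in> Ob C \<Longrightarrow>
      \<sigma> X (Y \<odot> Z) = (Ide C Y \<otimes> \<sigma> X Z) \<cdot> (\<sigma> X Y \<otimes> Ide C Z)"

section \<open>Lax and colax monoidal structures on a functor\<close>

record ('o1, 'a1, 'o2, 'a2) cat_map =
  FO :: "'o1 \<Rightarrow> 'o2"
  FA :: "'a1 \<Rightarrow> 'a2"

locale cat_functor = C: category C + D: category D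
  for C (structure) and D (structure) +
  fixes F :: "('o1, 'a1, 'o2, 'a2) cat_map"
  assumes FO_Ob: "X \<in> Ob C \<Longrightarrow> FO F X \<in> Ob D"
    and FA_Hom: "f \<in> Hom C X Y \<Longrightarrow> FA F f \<in> Hom D (FO F X) (FO F Y)"
    and FA_Ide: "X \<in> Ob C \<Longrightarrow> FA F (Ide C X) = Ide D (FO F X)"
    and FA_Cmp: "f \<in> Hom C X Y \<Longrightarrow> g \<in> Hom C Y Z \<Longrightarrow>
      FA F (g \<cdot>\<^bsub>C\<^esub> f) = FA F g \<cdot>\<^bsub>D\<^esub> FA F f"

locale colax_monoidal_structure =
  C: strict_monoidal_category C + D: strict_monoidal_category D + cat_functor C D F
  for C (structure) and D (structure) and F +
  fixes c :: "'o1 \<Rightarrow> 'o1 \<Rightarrow> 'a2" and \<alpha> :: 'a2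
  assumes colax_Hom: "X \<in> Ob C \<Longrightarrow> Y \<in> Ob C \<Longrightarrow>
      c X Y \<in> Hom D (FO F (X \<odot>\<^bsub>C\<^esub> Y)) (FO F X \<odot>\<^bsub>D\<^esub> FO F Y)"
    and colax_natural: "f \<in> Hom C X X' \<Longrightarrow> g \<in> Hom C Y Y' \<Longrightarrow>
      c X' Y' \<cdot>\<^bsub>D\<^esub> FA F (f \<otimes>\<^bsub>C\<^esub> g) = (FA F f \<otimes>\<^bsub>D\<^esub> FA F g) \<cdot>\<^bsub>D\<^esub> c X Y"
    and counit_Hom: "\<alpha> \<in> Hom D (FO F \<one>\<^bsub>C\<^esub>) \<one>\<^bsub>D\<^esub>"
    and colax_coassoc: "X \<in> Ob C \<Longrightarrow> Y \<in> Ob C \<Longrightarrow> Z \<in> Ob C \<Longrightarrow>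
      (c X Y \<otimes>\<^bsub>D\<^esub> Ide D (FO F Z)) \<cdot>\<^bsub>D\<^esub> c (X \<odot>\<^bsub>C\<^esub> Y) Z =
      (Ide D (FO F X) \<otimes>\<^bsub>D\<^esub> c Y Z) \<cdot>\<^bsub>D\<^esub> c X (Y \<odot>\<^bsub>C\<^esub> Z)"
    and colax_counit_left: "X \<in> Ob C \<Longrightarrow>
      (\<alpha> \<otimes>\<^bsub>D\<^esub> Ide D (FO F X)) \<cdot>\<^bsub>D\<^esub> c \<one>\<^bsub>C\<^esub> X = Ide D (FO F X)"
    and colax_counit_right: "X \<in> Ob C \<Longrightarrow>
      (Ide D (FO F X) \<otimes>\<^bsub>D\<^esub> \<alpha>) \<cdot>\<^bsub>D\<^esub> c X \<one>\<^bsub>C\<^esub> = Ide D (FO F X)"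

locale lax_monoidal_structure =
  C: strict_monoidal_category C + D: strict_monoidal_category D + cat_functor C D F
  for C (structure) and D (structure) and F +
  fixes l :: "'o1 \<Rightarrow> 'o1 \<Rightarrow> 'a2" and \<kappa> :: 'a2
  assumes lax_Hom: "X \<in> Ob C \<Longrightarrow> Y \<in> Ob C \<Longrightarrow>
      l X Y \<in> Hom D (FO F X \<odot>\<^bsub>D\<^esub> FO F Y) (FO F (X \<odot>\<^bsub>C\<^esub> Y))"
    and lax_natural: "f \<in> Hom C X X' \<Longrightarrow> g \<in> Hom C Y Y' \<Longrightarrow>
      l X' Y' \<cdot>\<^bsub>D\<^esub> (FA F f \<otimes>\<^bsub>D\<^esub> FA F g) = FA F (f \<otimes>\<^bsub>C\<^esub> g) \<cdot>\<^bsub>D\<^esub> l X Y"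
    and unit_Hom: "\<kappa> \<in> Hom D \<one>\<^bsub>D\<^esub> (FO F \<one>\<^bsub>C\<^esub>)"
    and lax_assoc: "X \<in> Ob C \<Longrightarrow> Y \<in> Ob C \<Longrightarrow> Z \<in> Ob C \<Longrightarrow>
      l (X \<odot>\<^bsub>C\<^esub> Y) Z \<cdot>\<^bsub>D\<^esub> (l X Y \<otimes>\<^bsub>D\<^esub> Ide D (FO F Z)) =
      l X (Y \<odot>\<^bsub>C\<^esub> Z) \<cdot>\<^bsub>D\<^esub> (Ide D (FO F X) \<otimes>\<^bsub>D\<^esub> l Y Z)"
    and lax_unit_left: "X \<in> Ob C \<Longrightarrow>
      l \<one>\<^bsub>C\<^esub> X \<cdot>\<^bsub>D\<^esub> (\<kappa> \<otimes>\<^bsub>D\<^esub> Ide D (FO F X)) = Ide D (FO F X)"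
    and lax_unit_right: "X \<in> Ob C \<Longrightarrow>
      l X \<one>\<^bsub>C\<^esub> \<cdot>\<^bsub>D\<^esub> (Ide D (FO F X) \<otimes>\<^bsub>D\<^esub> \<kappa>) = Ide D (FO F X)"

locale symmetric_lax_monoidal_structure =
  C: strict_symmetric_monoidal_category C + D: strict_symmetric_monoidal_category D +
  lax_monoidal_structure C D F l \<kappa>
  for C (structure) and D (structure) and F l \<kappa> +
  assumes lax_symmetric: "X \<in> Ob C \<Longrightarrow> Y \<in> Ob C \<Longrightarrow>
      FA F (\<sigma>\<^bsub>C\<^esub> X Y) \<cdot>\<^bsub>D\<^esub> l X Y = l Y X \<cdot>\<^bsub>D\<^esub> \<sigma>\<^bsub>D\<^esub> (FO F X) (FO F Y)"

section \<open>The bialgebra axiom\<close>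

text \<open>\<open>id \<otimes> \<sigma> \<otimes> id : X \<odot> Y \<odot> Z \<odot> W \<rightarrow> X \<odot> Z \<odot> Y \<odot> W\<close>\<close>

definition mid_swap ::
    "('o, 'a, 'm) sym_mon_cat_scheme \<Rightarrow> 'o \<Rightarrow> 'o \<Rightarrow> 'o \<Rightarrow> 'o \<Rightarrow> 'a" where
  "mid_swap C X Y Z W = Ide C X \<otimes>\<^bsub>C\<^esub> \<sigma>\<^bsub>C\<^esub> Y Z \<otimes>\<^bsub>C\<^esub> Ide C W"

locale bialgebra_axiom =
  C: strict_symmetric_monoidal_category C + D: strict_symmetric_monoidal_category D +
  colax_monoidal_structure C D F c \<alpha> + lax_monoidal_structure C D F l \<kappa>
  for C (structure) and D (structure) and F c \<alpha> l \<kappa> +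
  assumes bialgebra: "X \<in> Ob C \<Longrightarrow> Y \<in> Ob C \<Longrightarrow> Z \<in> Ob C \<Longrightarrow> W \<in> Ob C \<Longrightarrow>
      c (X \<odot>\<^bsub>C\<^esub> Z) (Y \<odot>\<^bsub>C\<^esub> W) \<cdot>\<^bsub>D\<^esub> FA F (mid_swap C X Y Z W) \<cdot>\<^bsub>D\<^esub>
        l (X \<odot>\<^bsub>C\<^esub> Y) (Z \<odot>\<^bsub>C\<^esub> W) =
      (l X Z \<otimes>\<^bsub>D\<^esub> l Y W) \<cdot>\<^bsub>D\<^esub> mid_swap D (FO F X) (FO F Y) (FO F Z) (FO F W) \<cdot>\<^bsub>D\<^esub>
        (c X Y \<otimes>\<^bsub>D\<^esub> c Z W)"

text \<open>Compatibility with the units is not a consequence of the four-object diagram. For a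
  field \<open>k\<close>, the zero functor to \<open>k\<close>-vector spaces satisfies everything above with all
  structure maps zero, but no \<open>F(\<one>) = 0 \<rightarrow> k\<close> preserves units. Nonzero example: \<open>C\<close> terminal
  and \<open>F\<close> picking the real algebra of complex numbers, with comultiplication
  \<open>z \<mapsto> (z \<otimes> 1 - z i \<otimes> i) / 2\<close> and counit \<open>z \<mapsto> 2 Re z\<close>; it has no algebra map
  to the real numbers. The
  equations below say that \<open>c \<one> \<one>\<close> preserves the unit and that \<open>\<alpha>\<close> preserves product
  and unit of the monoid \<open>F(\<one>)\<close>. Given the four-object diagram, they are necessary and sufficient
  for \<open>c\<close> and \<open>\<alpha>\<close> to consist of monoid maps.\<close>

definition bialgebra_unit_axiom ::
    "('o1, 'a1, 'm1) mon_cat_scheme \<Rightarrow> ('o2, 'a2, 'm2) mon_cat_scheme \<Rightarrow>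
     ('o1 \<Rightarrow> 'o1 \<Rightarrow> 'a2) \<Rightarrow> 'a2 \<Rightarrow> ('o1 \<Rightarrow> 'o1 \<Rightarrow> 'a2) \<Rightarrow> 'a2 \<Rightarrow> bool" where
  "bialgebra_unit_axiom C D c \<alpha> l \<kappa> \<longleftrightarrow>
     c \<one>\<^bsub>C\<^esub> \<one>\<^bsub>C\<^esub> \<cdot>\<^bsub>D\<^esub> \<kappa> = \<kappa> \<otimes>\<^bsub>D\<^esub> \<kappa> \<and>
     \<alpha> \<cdot>\<^bsub>D\<^esub> l \<one>\<^bsub>C\<^esub> \<one>\<^bsub>C\<^esub> = \<alpha> \<otimes>\<^bsub>D\<^esub> \<alpha> \<and>
     \<alpha> \<cdot>\<^bsub>D\<^esub> \<kappa> = Ide D \<one>\<^bsub>D\<^esub>"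

section \<open>Monoids\<close>

datatype ('o, 'a) mon = Mon (carr: 'o) (mul: 'a) (uni: 'a)

text \<open>A morphism of monoids records its source and target, since the underlying arrow does not
  determine them.\<close>

datatype ('o, 'a) mon_arr =
  MonArr (src: "('o, 'a) mon") (tgt: "('o, 'a) mon") (und: 'a)

definition is_monoid :: "('o, 'a, 'm) mon_cat_scheme \<Rightarrow> ('o, 'a) mon \<Rightarrow> bool" where
  "is_monoid C M \<longleftrightarrow>
     carr M \<in> Ob C \<and>
     mul M \<in> Hom C (carr M \<odot>\<^bsub>C\<^esub> carr M) (carr M) \<and>
     uni M \<in> Hom C \<one>\<^bsub>C\<^esub> (carr M) \<and>
     mul M \<cdot>\<^bsub>C\<^esub> (mul M \<otimes>\<^bsub>C\<^esub> Ide C (carr M)) = mul M \<cdot>\<^bsub>C\<^esub> (Ide C (carr M) \<otimes>\<^bsub>C\<^esub> mul M) \<and>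
     mul M \<cdot>\<^bsub>C\<^esub> (uni M \<otimes>\<^bsub>C\<^esub> Ide C (carr M)) = Ide C (carr M) \<and>
     mul M \<cdot>\<^bsub>C\<^esub> (Ide C (carr M) \<otimes>\<^bsub>C\<^esub> uni M) = Ide C (carr M)"

definition is_monoid_hom :: "('o, 'a, 'm) mon_cat_scheme \<Rightarrow> ('o, 'a) mon_arr \<Rightarrow> bool" where
  "is_monoid_hom C f \<longleftrightarrow>
     is_monoid C (src f) \<and> is_monoid C (tgt f) \<and>
     und f \<in> Hom C (carr (src f)) (carr (tgt f)) \<and>
     und f \<cdot>\<^bsub>C\<^esub> mul (src f) = mul (tgt f) \<cdot>\<^bsub>C\<^esub> (und f \<otimes>\<^bsub>C\<^esub> und f) \<and>
     und f \<cdot>\<^bsub>C\<^esub> uni (src f) = uni (tgt f)"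

definition mon_tensor ::
    "('o, 'a, 'm) sym_mon_cat_scheme \<Rightarrow> ('o, 'a) mon \<Rightarrow> ('o, 'a) mon \<Rightarrow> ('o, 'a) mon" where
  "mon_tensor C M N =
     Mon (carr M \<odot>\<^bsub>C\<^esub> carr N)
       ((mul M \<otimes>\<^bsub>C\<^esub> mul N) \<cdot>\<^bsub>C\<^esub> mid_swap C (carr M) (carr N) (carr M) (carr N))
       (uni M \<otimes>\<^bsub>C\<^esub> uni N)"

definition MON ::
    "('o, 'a, 'm) sym_mon_cat_scheme \<Rightarrow> (('o, 'a) mon, ('o, 'a) mon_arr) sym_mon_cat" where
  "MON C = \<lparr>
     Ob = {M. is_monoid C M},
     Ar = {f. is_monoid_hom C f},
     Dom = src,
     Cod = tgt,
     Ide = (\<lambda>M. MonArr M M (Ide C (carr M))),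
     Cmp = (\<lambda>g f. MonArr (src f) (tgt g) (und g \<cdot>\<^bsub>C\<^esub> und f)),
     TenO = mon_tensor C,
     TenA = (\<lambda>f g. MonArr (mon_tensor C (src f) (src g)) (mon_tensor C (tgt f) (tgt g))
                      (und f \<otimes>\<^bsub>C\<^esub> und g)),
     Unit = Mon \<one>\<^bsub>C\<^esub> (Ide C \<one>\<^bsub>C\<^esub>) (Ide C \<one>\<^bsub>C\<^esub>),
     Sym = (\<lambda>M N. MonArr (mon_tensor C M N) (mon_tensor C N M) (\<sigma>\<^bsub>C\<^esub> (carr M) (carr N))) \<rparr>"

definition mon_image ::
    "('o2, 'a2, 'm) cat_scheme \<Rightarrow> ('o1, 'a1, 'o2, 'a2) cat_map \<Rightarrow>
     ('o1 \<Rightarrow> 'o1 \<Rightarrow> 'a2) \<Rightarrow> 'a2 \<Rightarrow> ('o1, 'a1) mon \<Rightarrow> ('o2, 'a2) mon" where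
  "mon_image D F l \<kappa> M =
     Mon (FO F (carr M))
       (FA F (mul M) \<cdot>\<^bsub>D\<^esub> l (carr M) (carr M))
       (FA F (uni M) \<cdot>\<^bsub>D\<^esub> \<kappa>)"

definition mon_functor ::
    "('o2, 'a2, 'm) cat_scheme \<Rightarrow> ('o1, 'a1, 'o2, 'a2) cat_map \<Rightarrow>
     ('o1 \<Rightarrow> 'o1 \<Rightarrow> 'a2) \<Rightarrow> 'a2 \<Rightarrow>
     (('o1, 'a1) mon, ('o1, 'a1) mon_arr, ('o2, 'a2) mon, ('o2, 'a2) mon_arr) cat_map" where
  "mon_functor D F l \<kappa> = \<lparr>
     FO = mon_image D F l \<kappa>,
     FA = (\<lambda>f. MonArr (mon_image D F l \<kappa> (src f)) (mon_image D F l \<kappa> (tgt f)) (FA F (und f))) \<rparr>"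

definition mon_lax ::
    "('o1, 'a1, 'm1) sym_mon_cat_scheme \<Rightarrow> ('o2, 'a2, 'm2) sym_mon_cat_scheme \<Rightarrow>
     ('o1, 'a1, 'o2, 'a2) cat_map \<Rightarrow> ('o1 \<Rightarrow> 'o1 \<Rightarrow> 'a2) \<Rightarrow> 'a2 \<Rightarrow>
     ('o1, 'a1) mon \<Rightarrow> ('o1, 'a1) mon \<Rightarrow> ('o2, 'a2) mon_arr" where
  "mon_lax C D F l \<kappa> M N =
     MonArr (mon_tensor D (mon_image D F l \<kappa> M) (mon_image D F l \<kappa> N))
       (mon_image D F l \<kappa> (mon_tensor C M N))
       (l (carr M) (carr N))"

definition mon_lax_unit ::
    "('o1, 'a1, 'm1) sym_mon_cat_scheme \<Rightarrow> ('o2, 'a2, 'm2) sym_mon_cat_scheme \<Rightarrow>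
     ('o1, 'a1, 'o2, 'a2) cat_map \<Rightarrow> ('o1 \<Rightarrow> 'o1 \<Rightarrow> 'a2) \<Rightarrow> 'a2 \<Rightarrow> ('o2, 'a2) mon_arr" where
  "mon_lax_unit C D F l \<kappa> =
     MonArr \<one>\<^bsub>MON D\<^esub> (mon_image D F l \<kappa> \<one>\<^bsub>MON C\<^esub>) \<kappa>"

end

theory Submission
  imports Defs
begin

text \<open>
  Since \<open>\<sigma>\<close> is a symmetry, \<open>\<otimes>\<close> is itself a lax monoidal functor with structure map
  \<open>id \<otimes> \<sigma> \<otimes> id\<close>; this makes monoids a strict symmetric monoidal category. Symmetry of
  \<open>\<ell>\<close> says that its components are monoid maps \<open>F(M) \<otimes> F(N) \<rightarrow> F(M \<otimes> N)\<close>. By naturality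
  of \<open>c\<close>, the bialgebra axiom at the objects \<open>A, B, A, B\<close> says exactly that \<open>c\<close> preserves the
  products of \<open>F(M \<otimes> N)\<close> and \<open>F(M) \<otimes> F(N)\<close> when \<open>M, N\<close> have carriers \<open>A, B\<close>; the unit
  axiom does the same for units and for \<open>\<alpha>\<close>. So \<open>c\<close> and \<open>\<alpha>\<close> lift to monoids, and all
  equations between the lifts hold because they hold for the underlying arrows.
\<close>

section \<open>Strict symmetric monoidal categories\<close>

lemma HomI: "f \<in> Ar C \<Longrightarrow> Dom C f = X \<Longrightarrow> Cod C f = Y \<Longrightarrow> f \<in> Hom C X Y"
  by (simp add: Hom_def)

lemma HomD:
  assumes "f \<in> Hom C X Y"
  shows "f \<in> Ar C" "Dom C f = X" "Cod C f = Y"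
  using assms by (auto simp: Hom_def)

section \<open>The category axioms in terms of sources and targets\<close>

context category
begin

text \<open>The axioms speak of hom-sets, whose endpoints the simplifier would often have to guess.
  In terms of \<open>Dom\<close> and \<open>Cod\<close> the side conditions can be computed, and
  composites end up bracketed to the right.\<close>

lemma Ide_simps [simp]:
  assumes "X \<in> Ob C"
  shows "Ide C X \<in> Ar C" "Dom C (Ide C X) = X" "Cod C (Ide C X) = X"
  using HomD[OF Ide_Hom[OF assms]] by auto

lemma Dom_Cod_Ob [simp]:
  assumes "f \<in> Ar C"
  shows "Dom C f \<in> Ob C" "Cod C f \<in> Ob C"
  using assms by (auto intro: Dom_Ob Cod_Ob)

lemma Cmp_simps [simp]:
  assumes "f \<in> Ar C" "g \<in> Ar C" "Dom C g = Cod C f"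
  shows "g \<cdot> f \<in> Ar C" "Dom C (g \<cdot> f) = Dom C f" "Cod C (g \<cdot> f) = Cod C g"
  using HomD[OF Cmp_Hom[of f "Dom C f" "Cod C f" g "Cod C g"]] assms
  by (auto simp: Hom_def)

lemma Cmp_Ide' [simp]: "f \<in> Ar C \<Longrightarrow> Dom C f = X \<Longrightarrow> f \<cdot> Ide C X = f"
  by (rule Cmp_Ide) (auto simp: Hom_def)

lemma Ide_Cmp' [simp]: "f \<in> Ar C \<Longrightarrow> Cod C f = X \<Longrightarrow> Ide C X \<cdot> f = f"
  by (rule Ide_Cmp) (auto simp: Hom_def)

lemma Cmp_assoc' [simp]:
  assumes "f \<in> Ar C" "g \<in> Ar C" "h \<in> Ar C" "Dom C g = Cod C f" "Dom C h = Cod C g"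
  shows "(h \<cdot> g) \<cdot> f = h \<cdot> g \<cdot> f"
  using Cmp_assoc[of f "Dom C f" "Cod C f" g "Cod C g" h "Cod C h"] assms
  by (auto simp: Hom_def)

end

section \<open>Functoriality of the tensor product\<close>

context strict_monoidal_category
begin

lemma TenA_simps [simp]:
  assumes "f \<in> Ar C" "g \<in> Ar C"
  shows "f \<otimes> g \<in> Ar C" "Dom C (f \<otimes> g) = Dom C f \<odot> Dom C g"
    "Cod C (f \<otimes> g) = Cod C f \<odot> Cod C g"
  using HomD[OF TenA_Hom[of f "Dom C f" "Cod C f" g "Dom C g" "Cod C g"]] assms
  by (auto simp: Hom_def)

lemmas monoidal_simps [simp] =
  TenO_Ob Unit_Ob TenO_assoc TenA_assoc Unit_TenO TenO_Unit Unit_TenA TenA_Unit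

text \<open>Oriented so that composites of tensors merge factor by factor. It is not a global simp
  rule, because later calculations also split tensors, through
  \<open>interchange[symmetric]\<close>, \<open>Ide_TenA_Cmp\<close> and
  \<open>Cmp_TenA_Ide\<close>.\<close>

lemma interchange:
  assumes "f \<in> Ar C" "f' \<in> Ar C" "g \<in> Ar C" "g' \<in> Ar C" "Dom C f' = Cod C f" "Dom C g' = Cod C g"
  shows "(f' \<otimes> g') \<cdot> (f \<otimes> g) = (f' \<cdot> f) \<otimes> (g' \<cdot> g)"
  by (rule TenA_Cmp[symmetric, of f "Dom C f" "Cod C f" f' "Cod C f'" g "Dom C g" "Cod C g" g' "Cod C g'"])
    (use assms in \<open>auto simp: Hom_def\<close>)

text \<open>Arrows on disjoint factors commute: both orders have the same normal form
  \<open>f \<otimes> g\<close>, so the two equations together slide one arrow past the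
  other.\<close>

lemma interchange_whisker:
  assumes "f \<in> Ar C" "g \<in> Ar C" "Dom C f = A" "Cod C f = A'" "Dom C g = B" "Cod C g = B'"
  shows "(f \<otimes> Ide C B') \<cdot> (Ide C A \<otimes> g) = f \<otimes> g"
    "(Ide C A' \<otimes> g) \<cdot> (f \<otimes> Ide C B) = f \<otimes> g"
  using assms by (auto simp: interchange)

lemma interchange3:
  assumes "f \<in> Ar C" "f' \<in> Ar C" "g \<in> Ar C" "g' \<in> Ar C" "h \<in> Ar C" "h' \<in> Ar C"
    "Dom C f' = Cod C f" "Dom C g' = Cod C g" "Dom C h' = Cod C h"
  shows "(f' \<otimes> g' \<otimes> h') \<cdot> (f \<otimes> g \<otimes> h) = (f' \<cdot> f) \<otimes> (g' \<cdot> g) \<otimes> (h' \<cdot> h)"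
  using assms by (simp add: interchange)

lemma whisker_Cmp:
  assumes "f \<in> Ar C" "g \<in> Ar C" "Dom C g = Cod C f" "X \<in> Ob C" "W \<in> Ob C"
  shows "(Ide C X \<otimes> g \<otimes> Ide C W) \<cdot> (Ide C X \<otimes> f \<otimes> Ide C W) = Ide C X \<otimes> (g \<cdot> f) \<otimes> Ide C W"
  using assms by (simp add: interchange)

lemma Ide_TenA_Cmp:
  assumes "f \<in> Ar C" "g \<in> Ar C" "Dom C g = Cod C f" "X \<in> Ob C"
  shows "Ide C X \<otimes> (g \<cdot> f) = (Ide C X \<otimes> g) \<cdot> (Ide C X \<otimes> f)"
  using assms by (simp add: interchange)

lemma Cmp_TenA_Ide:
  assumes "f \<in> Ar C" "g \<in> Ar C" "Dom C g = Cod C f" "X \<in> Ob C"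
  shows "(g \<cdot> f) \<otimes> Ide C X = (g \<otimes> Ide C X) \<cdot> (f \<otimes> Ide C X)"
  using assms by (simp add: interchange)

end

section \<open>The symmetry and the exchange of middle factors\<close>

context strict_symmetric_monoidal_category
begin

lemma Sym_simps [simp]:
  assumes "X \<in> Ob C" "Y \<in> Ob C"
  shows "\<sigma> X Y \<in> Ar C" "Dom C (\<sigma> X Y) = X \<odot> Y" "Cod C (\<sigma> X Y) = Y \<odot> X"
  using HomD[OF Sym_Hom[OF assms]] by auto

text \<open>The hexagon at \<open>X\<close>, \<open>\<one>\<close>, \<open>\<one>\<close> makes
  \<open>\<sigma> X \<one>\<close> idempotent, and an idempotent with a left inverse is an
  identity.\<close>

lemma Sym_Unit [simp]:
  assumes X: "X \<in> Ob C"
  shows "\<sigma> X \<one> = Ide C X" "\<sigma> \<one> X = Ide C X"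
proof -
  have idem: "\<sigma> X \<one> = \<sigma> X \<one> \<cdot> \<sigma> X \<one>"
    using Sym_hexagon[of X \<one> \<one>] X by simp
  have inv: "\<sigma> \<one> X \<cdot> \<sigma> X \<one> = Ide C X" using Sym_inverse[of X \<one>] X by simp
  have "\<sigma> X \<one> = (\<sigma> \<one> X \<cdot> \<sigma> X \<one>) \<cdot> \<sigma> X \<one>" using inv X by simp
  also have "\<dots> = \<sigma> \<one> X \<cdot> \<sigma> X \<one> \<cdot> \<sigma> X \<one>" using X by simp
  also have "\<dots> = Ide C X" by (simp only: idem[symmetric] inv)
  finally show "\<sigma> X \<one> = Ide C X" .
  with inv show "\<sigma> \<one> X = Ide C X" using X by simp
qed

text \<open>Inverting both sides of the given hexagon.\<close>

lemma Sym_hexagon_left: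
  assumes [simp]: "X \<in> Ob C" "Y \<in> Ob C" "Z \<in> Ob C"
  shows "\<sigma> (X \<odot> Y) Z = (\<sigma> X Z \<otimes> Ide C Y) \<cdot> (Ide C X \<otimes> \<sigma> Y Z)"
proof -
  let ?f = "(\<sigma> X Z \<otimes> Ide C Y) \<cdot> (Ide C X \<otimes> \<sigma> Y Z)"
  let ?g = "\<sigma> Z (X \<odot> Y)"
  have g: "?g = (Ide C X \<otimes> \<sigma> Z Y) \<cdot> (\<sigma> Z X \<otimes> Ide C Y)"
    by (rule Sym_hexagon) simp_all
  have "(\<sigma> Z X \<otimes> Ide C Y) \<cdot> ?f = ((\<sigma> Z X \<cdot> \<sigma> X Z) \<otimes> Ide C Y) \<cdot> (Ide C X \<otimes> \<sigma> Y Z)"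
    by (simp add: Cmp_TenA_Ide)
  also have "\<dots> = Ide C X \<otimes> \<sigma> Y Z"
    by (simp add: Sym_inverse TenA_Ide)
  finally have "?g \<cdot> ?f = (Ide C X \<otimes> \<sigma> Z Y) \<cdot> (Ide C X \<otimes> \<sigma> Y Z)"
    by (simp add: g)
  also have "\<dots> = Ide C (X \<odot> Y \<odot> Z)"
    by (simp add: interchange Sym_inverse TenA_Ide)
  finally have gf: "?g \<cdot> ?f = Ide C (X \<odot> Y \<odot> Z)" .
  \<comment> \<open>\<open>?g\<close> has \<open>?f\<close> as a right inverse and
    \<open>\<sigma> (X \<odot> Y) Z\<close> as a left inverse, so these two coincide.\<close>
  have "\<sigma> (X \<odot> Y) Z = \<sigma> (X \<odot> Y) Z \<cdot> ?g \<cdot> ?f"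
    unfolding gf by simp
  also have "\<dots> = (\<sigma> (X \<odot> Y) Z \<cdot> ?g) \<cdot> ?f"
    by simp
  also have "\<dots> = ?f" by (simp add: Sym_inverse)
  finally show ?thesis .
qed

lemma mid_swap_simps [simp]:
  assumes "X \<in> Ob C" "Y \<in> Ob C" "Z \<in> Ob C" "W \<in> Ob C"
  shows "mid_swap C X Y Z W \<in> Ar C"
    "Dom C (mid_swap C X Y Z W) = X \<odot> Y \<odot> Z \<odot> W"
    "Cod C (mid_swap C X Y Z W) = X \<odot> Z \<odot> Y \<odot> W"
  using assms by (simp_all add: mid_swap_def)

text \<open>In each case one of the two exchanged factors is \<open>\<one>\<close>, so
  \<open>Sym_Unit\<close> applies. The first two equations serve the unit laws of a tensor product
  of monoids, the last two the tensor product with the unit monoid.\<close>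

lemma mid_swap_Unit [simp]:
  assumes "X \<in> Ob C" "Y \<in> Ob C"
  shows "mid_swap C X Y \<one> \<one> = Ide C (X \<odot> Y)" "mid_swap C \<one> \<one> X Y = Ide C (X \<odot> Y)"
    "mid_swap C X \<one> Y \<one> = Ide C (X \<odot> Y)" "mid_swap C \<one> X \<one> Y = Ide C (X \<odot> Y)"
  using assms by (simp_all add: mid_swap_def TenA_Ide)

lemma mid_swap_natural:
  assumes "f \<in> Hom C X X'" "g \<in> Hom C Y Y'" "h \<in> Hom C Z Z'" "k \<in> Hom C W W'"
  shows "mid_swap C X' Y' Z' W' \<cdot> (f \<otimes> g \<otimes> h \<otimes> k) = (f \<otimes> h \<otimes> g \<otimes> k) \<cdot> mid_swap C X Y Z W"
proof -
  note H [simp] = assms[THEN HomD(1)] assms[THEN HomD(2)] assms[THEN HomD(3)]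
  have O [simp]: "X \<in> Ob C" "X' \<in> Ob C" "Y \<in> Ob C" "Y' \<in> Ob C" "Z \<in> Ob C" "Z' \<in> Ob C"
    "W \<in> Ob C" "W' \<in> Ob C"
    using Dom_Ob[OF H(1)] Dom_Ob[OF H(2)] Dom_Ob[OF H(3)] Dom_Ob[OF H(4)]
      Cod_Ob[OF H(1)] Cod_Ob[OF H(2)] Cod_Ob[OF H(3)] Cod_Ob[OF H(4)] by simp_all
  \<comment> \<open>Bracketing \<open>g \<otimes> h\<close> as one arrow gives three factors for
    \<open>interchange3\<close>, with naturality of \<open>\<sigma>\<close> needed only in the
    second.\<close>
  have "mid_swap C X' Y' Z' W' \<cdot> (f \<otimes> (g \<otimes> h) \<otimes> k) = f \<otimes> (\<sigma> Y' Z' \<cdot> (g \<otimes> h)) \<otimes> k"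
    unfolding mid_swap_def by (subst interchange3) simp_all
  also have "\<dots> = f \<otimes> ((h \<otimes> g) \<cdot> \<sigma> Y Z) \<otimes> k"
    by (simp add: Sym_natural[OF assms(2,3)])
  also have "\<dots> = (f \<otimes> (h \<otimes> g) \<otimes> k) \<cdot> mid_swap C X Y Z W"
    unfolding mid_swap_def by (subst interchange3) simp_all
  finally show ?thesis by simp
qed

text \<open>The next three lemmas say that \<open>\<otimes>\<close>, with structure map \<open>mid_swap\<close>, is a lax monoidal
  functor on pairs of objects, that it is associative as such, and that \<open>\<sigma>\<close> is a monoidal
  transformation.\<close>

lemma mid_swap_lax_assoc:
  assumes [simp]: "X \<in> Ob C" "Y \<in> Ob C" "X' \<in> Ob C" "Y' \<in> Ob C" "X'' \<in> Ob C" "Y'' \<in> Ob C"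
  shows "mid_swap C (X \<odot> X') (Y \<odot> Y') X'' Y'' \<cdot> (mid_swap C X Y X' Y' \<otimes> Ide C (X'' \<odot> Y'')) =
    mid_swap C X Y (X' \<odot> X'') (Y' \<odot> Y'') \<cdot> (Ide C (X \<odot> Y) \<otimes> mid_swap C X' Y' X'' Y'')"
proof -
  \<comment> \<open>The outer factors \<open>X\<close> and \<open>Y''\<close> stay fixed. By the
    hexagons, each side moves \<open>Y\<close> past \<open>X'\<close> and \<open>Y'\<close> past
    \<open>X''\<close>, and then \<open>Y\<close> past \<open>X''\<close>. The sides differ only in
    the order of the first two moves, which act on disjoint factors.\<close>
  have core: "(Ide C X' \<otimes> \<sigma> (Y \<odot> Y') X'') \<cdot> (\<sigma> Y X' \<otimes> Ide C (Y' \<odot> X'')) =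
      (\<sigma> Y (X' \<odot> X'') \<otimes> Ide C Y') \<cdot> (Ide C (Y \<odot> X') \<otimes> \<sigma> Y' X'')"
  proof -
    have "(Ide C X' \<otimes> \<sigma> (Y \<odot> Y') X'') \<cdot> (\<sigma> Y X' \<otimes> Ide C (Y' \<odot> X'')) =
      (Ide C X' \<otimes> \<sigma> Y X'' \<otimes> Ide C Y') \<cdot> (Ide C (X' \<odot> Y) \<otimes> \<sigma> Y' X'') \<cdot> (\<sigma> Y X' \<otimes> Ide C (Y' \<odot> X''))"
      by (simp add: Sym_hexagon_left Ide_TenA_Cmp TenA_Ide[symmetric])
    also have "\<dots> = (Ide C X' \<otimes> \<sigma> Y X'' \<otimes> Ide C Y') \<cdot> (\<sigma> Y X' \<otimes> Ide C (X'' \<odot> Y')) \<cdot>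
        (Ide C (Y \<odot> X') \<otimes> \<sigma> Y' X'')"
      by (simp add: interchange_whisker)
    also have "\<dots> = (\<sigma> Y (X' \<odot> X'') \<otimes> Ide C Y') \<cdot> (Ide C (Y \<odot> X') \<otimes> \<sigma> Y' X'')"
      by (simp add: Sym_hexagon[of Y X' X''] Cmp_TenA_Ide TenA_Ide[symmetric])
    finally show ?thesis .
  qed
  have "mid_swap C (X \<odot> X') (Y \<odot> Y') X'' Y'' \<cdot> (mid_swap C X Y X' Y' \<otimes> Ide C (X'' \<odot> Y'')) =
    (Ide C X \<otimes> (Ide C X' \<otimes> \<sigma> (Y \<odot> Y') X'') \<otimes> Ide C Y'') \<cdot>
      (Ide C X \<otimes> (\<sigma> Y X' \<otimes> Ide C (Y' \<odot> X'')) \<otimes> Ide C Y'')"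
    by (simp add: mid_swap_def TenA_Ide[symmetric])
  \<comment> \<open>Each composite is contracted to a single arrow whiskered by \<open>X\<close> and
    \<open>Y''\<close>; there \<open>core\<close> applies.\<close>
  also have "\<dots> = (Ide C X \<otimes> (\<sigma> Y (X' \<odot> X'') \<otimes> Ide C Y') \<otimes> Ide C Y'') \<cdot>
      (Ide C X \<otimes> (Ide C (Y \<odot> X') \<otimes> \<sigma> Y' X'') \<otimes> Ide C Y'')"
    by (subst (1 2) whisker_Cmp) (simp_all only: core, simp_all)
  also have "\<dots> = mid_swap C X Y (X' \<odot> X'') (Y' \<odot> Y'') \<cdot> (Ide C (X \<odot> Y) \<otimes> mid_swap C X' Y' X'' Y'')"
    by (simp add: mid_swap_def TenA_Ide[symmetric])
  finally show ?thesis .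
qed

lemma mid_swap_assoc:
  assumes [simp]: "X \<in> Ob C" "Y \<in> Ob C" "Z \<in> Ob C" "X' \<in> Ob C" "Y' \<in> Ob C" "Z' \<in> Ob C"
  shows "(mid_swap C X Y X' Y' \<otimes> Ide C (Z \<odot> Z')) \<cdot> mid_swap C (X \<odot> Y) Z (X' \<odot> Y') Z' =
    (Ide C (X \<odot> X') \<otimes> mid_swap C Y Z Y' Z') \<cdot> mid_swap C X (Y \<odot> Z) X' (Y' \<odot> Z')"
proof -
  \<comment> \<open>This time \<open>Z\<close> passes \<open>X'\<close> first; the remaining moves,
    \<open>Y\<close> past \<open>X'\<close> and \<open>Z\<close> past \<open>Y'\<close>, are
    disjoint and commute.\<close>
  have core: "(\<sigma> Y X' \<otimes> Ide C (Y' \<odot> Z)) \<cdot> (Ide C Y \<otimes> \<sigma> Z (X' \<odot> Y')) =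
      (Ide C (X' \<odot> Y) \<otimes> \<sigma> Z Y') \<cdot> (\<sigma> (Y \<odot> Z) X' \<otimes> Ide C Y')"
  proof -
    have "(\<sigma> Y X' \<otimes> Ide C (Y' \<odot> Z)) \<cdot> (Ide C Y \<otimes> \<sigma> Z (X' \<odot> Y')) =
      (\<sigma> Y X' \<otimes> Ide C (Y' \<odot> Z)) \<cdot> (Ide C (Y \<odot> X') \<otimes> \<sigma> Z Y') \<cdot> (Ide C Y \<otimes> \<sigma> Z X' \<otimes> Ide C Y')"
      by (simp add: Sym_hexagon Ide_TenA_Cmp TenA_Ide[symmetric])
    also have "\<dots> = ((\<sigma> Y X' \<otimes> Ide C (Y' \<odot> Z)) \<cdot> (Ide C (Y \<odot> X') \<otimes> \<sigma> Z Y')) \<cdot>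
        (Ide C Y \<otimes> \<sigma> Z X' \<otimes> Ide C Y')"
      by simp
    also have "\<dots> = ((Ide C (X' \<odot> Y) \<otimes> \<sigma> Z Y') \<cdot> (\<sigma> Y X' \<otimes> Ide C (Z \<odot> Y'))) \<cdot>
        (Ide C Y \<otimes> \<sigma> Z X' \<otimes> Ide C Y')"
      by (simp only: interchange_whisker assms TenO_Ob Sym_simps)
    also have "\<dots> = (Ide C (X' \<odot> Y) \<otimes> \<sigma> Z Y') \<cdot> (\<sigma> (Y \<odot> Z) X' \<otimes> Ide C Y')"
      by (simp add: Sym_hexagon_left[of Y Z X'] Cmp_TenA_Ide TenA_Ide[symmetric])
    finally show ?thesis .
  qed
  have "(mid_swap C X Y X' Y' \<otimes> Ide C (Z \<odot> Z')) \<cdot> mid_swap C (X \<odot> Y) Z (X' \<odot> Y') Z' =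
    (Ide C X \<otimes> (\<sigma> Y X' \<otimes> Ide C (Y' \<odot> Z)) \<otimes> Ide C Z') \<cdot>
      (Ide C X \<otimes> (Ide C Y \<otimes> \<sigma> Z (X' \<odot> Y')) \<otimes> Ide C Z')"
    by (simp add: mid_swap_def TenA_Ide[symmetric])
  also have "\<dots> = (Ide C X \<otimes> (Ide C (X' \<odot> Y) \<otimes> \<sigma> Z Y') \<otimes> Ide C Z') \<cdot>
      (Ide C X \<otimes> (\<sigma> (Y \<odot> Z) X' \<otimes> Ide C Y') \<otimes> Ide C Z')"
    by (subst (1 2) whisker_Cmp) (simp_all only: core, simp_all)
  also have "\<dots> = (Ide C (X \<odot> X') \<otimes> mid_swap C Y Z Y' Z') \<cdot> mid_swap C X (Y \<odot> Z) X' (Y' \<odot> Z')"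
    by (simp add: mid_swap_def TenA_Ide[symmetric])
  finally show ?thesis .
qed

lemma mid_swap_Sym:
  assumes [simp]: "X \<in> Ob C" "Y \<in> Ob C" "X' \<in> Ob C" "Y' \<in> Ob C"
  shows "\<sigma> (X \<odot> X') (Y \<odot> Y') \<cdot> mid_swap C X Y X' Y' =
    mid_swap C Y X Y' X' \<cdot> (\<sigma> X Y \<otimes> \<sigma> X' Y')"
proof -
  \<comment> \<open>Both hexagons together split the exchange of the two pairs into four elementary
    ones.\<close>
  have "\<sigma> (X \<odot> X') (Y \<odot> Y') = (\<sigma> X (Y \<odot> Y') \<otimes> Ide C X') \<cdot> (Ide C X \<otimes> \<sigma> X' (Y \<odot> Y'))"
    by (rule Sym_hexagon_left) simp_all
  also have "\<dots> = (Ide C Y \<otimes> \<sigma> X Y' \<otimes> Ide C X') \<cdot> (\<sigma> X Y \<otimes> Ide C (Y' \<odot> X')) \<cdot>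
      (Ide C (X \<odot> Y) \<otimes> \<sigma> X' Y') \<cdot> (Ide C X \<otimes> \<sigma> X' Y \<otimes> Ide C Y')"
    by (simp add: Sym_hexagon Cmp_TenA_Ide Ide_TenA_Cmp TenA_Ide[symmetric])
  finally have "\<sigma> (X \<odot> X') (Y \<odot> Y') \<cdot> mid_swap C X Y X' Y' =
      (Ide C Y \<otimes> \<sigma> X Y' \<otimes> Ide C X') \<cdot> (\<sigma> X Y \<otimes> Ide C (Y' \<odot> X')) \<cdot> (Ide C (X \<odot> Y) \<otimes> \<sigma> X' Y') \<cdot>
      (Ide C X \<otimes> \<sigma> X' Y \<otimes> Ide C Y') \<cdot> (Ide C X \<otimes> \<sigma> Y X' \<otimes> Ide C Y')"
    by (simp add: mid_swap_def)
  \<comment> \<open>The first of the four exchanges undoes the one performed by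
    \<open>mid_swap C X Y X' Y'\<close>; the other three make up the right-hand side.\<close>
  also have "(Ide C X \<otimes> \<sigma> X' Y \<otimes> Ide C Y') \<cdot> (Ide C X \<otimes> \<sigma> Y X' \<otimes> Ide C Y') =
      Ide C (X \<odot> Y \<odot> X' \<odot> Y')"
    by (simp add: whisker_Cmp Sym_inverse TenA_Ide)
  also have "(Ide C Y \<otimes> \<sigma> X Y' \<otimes> Ide C X') \<cdot> (\<sigma> X Y \<otimes> Ide C (Y' \<odot> X')) \<cdot>
      (Ide C (X \<odot> Y) \<otimes> \<sigma> X' Y') \<cdot> Ide C (X \<odot> Y \<odot> X' \<odot> Y') =
      mid_swap C Y X Y' X' \<cdot> (\<sigma> X Y \<otimes> \<sigma> X' Y')"
    by (simp add: mid_swap_def interchange_whisker)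
  finally show ?thesis .
qed

end

section \<open>The category of monoids\<close>

lemma mon_tensor_simps [simp]:
  "carr (mon_tensor C M N) = carr M \<odot>\<^bsub>C\<^esub> carr N"
  "mul (mon_tensor C M N) =
    (mul M \<otimes>\<^bsub>C\<^esub> mul N) \<cdot>\<^bsub>C\<^esub> mid_swap C (carr M) (carr N) (carr M) (carr N)"
  "uni (mon_tensor C M N) = uni M \<otimes>\<^bsub>C\<^esub> uni N"
  by (simp_all add: mon_tensor_def)

lemma is_monoid_simps [simp]:
  assumes "is_monoid C M"
  shows "carr M \<in> Ob C" "mul M \<in> Ar C" "Dom C (mul M) = carr M \<odot>\<^bsub>C\<^esub> carr M"
    "Cod C (mul M) = carr M" "uni M \<in> Ar C" "Dom C (uni M) = \<one>\<^bsub>C\<^esub>" "Cod C (uni M) = carr M"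
  using assms by (auto simp: is_monoid_def Hom_def)

lemma is_monoidD:
  assumes "is_monoid C M"
  shows "mul M \<cdot>\<^bsub>C\<^esub> (mul M \<otimes>\<^bsub>C\<^esub> Ide C (carr M)) = mul M \<cdot>\<^bsub>C\<^esub> (Ide C (carr M) \<otimes>\<^bsub>C\<^esub> mul M)"
    "mul M \<cdot>\<^bsub>C\<^esub> (uni M \<otimes>\<^bsub>C\<^esub> Ide C (carr M)) = Ide C (carr M)"
    "mul M \<cdot>\<^bsub>C\<^esub> (Ide C (carr M) \<otimes>\<^bsub>C\<^esub> uni M) = Ide C (carr M)"
  using assms unfolding is_monoid_def by simp_all

lemma is_monoid_hom_simps [simp]:
  assumes "is_monoid_hom C f"
  shows "is_monoid C (src f)" "is_monoid C (tgt f)" "und f \<in> Ar C"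
    "Dom C (und f) = carr (src f)" "Cod C (und f) = carr (tgt f)"
  using assms by (auto simp: is_monoid_hom_def Hom_def)

lemma is_monoid_homD:
  assumes "is_monoid_hom C f"
  shows "und f \<cdot>\<^bsub>C\<^esub> mul (src f) = mul (tgt f) \<cdot>\<^bsub>C\<^esub> (und f \<otimes>\<^bsub>C\<^esub> und f)"
    "und f \<cdot>\<^bsub>C\<^esub> uni (src f) = uni (tgt f)"
  using assms unfolding is_monoid_hom_def by simp_all

lemma is_monoid_homI:
  assumes "is_monoid C M" "is_monoid C N" "f \<in> Ar C" "Dom C f = carr M" "Cod C f = carr N"
    "f \<cdot>\<^bsub>C\<^esub> mul M = mul N \<cdot>\<^bsub>C\<^esub> (f \<otimes>\<^bsub>C\<^esub> f)" "f \<cdot>\<^bsub>C\<^esub> uni M = uni N"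
  shows "is_monoid_hom C (MonArr M N f)"
  using assms unfolding is_monoid_hom_def by (simp add: Hom_def)

lemma MON_simps [simp]:
  "Ob (MON C) = {M. is_monoid C M}"
  "Ar (MON C) = {f. is_monoid_hom C f}"
  "Dom (MON C) = src"
  "Cod (MON C) = tgt"
  "Ide (MON C) M = MonArr M M (Ide C (carr M))"
  "g \<cdot>\<^bsub>MON C\<^esub> f = MonArr (src f) (tgt g) (und g \<cdot>\<^bsub>C\<^esub> und f)"
  "M \<odot>\<^bsub>MON C\<^esub> N = mon_tensor C M N"
  "f \<otimes>\<^bsub>MON C\<^esub> g = MonArr (mon_tensor C (src f) (src g)) (mon_tensor C (tgt f) (tgt g))
     (und f \<otimes>\<^bsub>C\<^esub> und g)"
  "\<one>\<^bsub>MON C\<^esub> = Mon \<one>\<^bsub>C\<^esub> (Ide C \<one>\<^bsub>C\<^esub>) (Ide C \<one>\<^bsub>C\<^esub>)"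
  "\<sigma>\<^bsub>MON C\<^esub> M N = MonArr (mon_tensor C M N) (mon_tensor C N M) (\<sigma>\<^bsub>C\<^esub> (carr M) (carr N))"
  by (simp_all add: MON_def)

lemma mid_swap_MON:
  "mid_swap (MON C) M N P Q = MonArr
     (mon_tensor C M (mon_tensor C (mon_tensor C N P) Q))
     (mon_tensor C M (mon_tensor C (mon_tensor C P N) Q))
     (mid_swap C (carr M) (carr N) (carr P) (carr Q))"
  by (simp add: mid_swap_def)

lemma Hom_MON_iff:
  "f \<in> Hom (MON C) M N \<longleftrightarrow> is_monoid_hom C f \<and> src f = M \<and> tgt f = N"
  by (simp add: Hom_def)

section \<open>Tensor products of monoids and of their morphisms\<close>

context strict_symmetric_monoidal_category
begin

lemma is_monoid_Unit: "is_monoid C (Mon \<one> (Ide C \<one>) (Ide C \<one>))"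
  unfolding is_monoid_def by (simp add: Hom_def)

text \<open>This is the argument that lax monoidal functors preserve monoids, applied to the tensor
  product itself: naturality of \<open>mid_swap\<close> collects the exchanges on one side,
  \<open>mid_swap_lax_assoc\<close> compares them, and the laws of \<open>M\<close> and
  \<open>N\<close> apply factor by factor.\<close>

lemma is_monoid_mon_tensor:
  assumes M: "is_monoid C M" and N: "is_monoid C N"
  shows "is_monoid C (mon_tensor C M N)"
proof -
  let ?A = "carr M" and ?B = "carr N"
  let ?s = "mid_swap C ?A ?B ?A ?B"
  note [simp] = M N
  have "mul (mon_tensor C M N) \<cdot> (mul (mon_tensor C M N) \<otimes> Ide C (?A \<odot> ?B)) =
      (mul M \<otimes> mul N) \<cdot> (mid_swap C ?A ?B ?A ?B \<cdot> (mul M \<otimes> mul N \<otimes> Ide C ?A \<otimes> Ide C ?B)) \<cdot>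
        (?s \<otimes> Ide C (?A \<odot> ?B))"
    by (simp add: Cmp_TenA_Ide TenA_Ide)
  also have "\<dots> = (mul M \<otimes> mul N) \<cdot> ((mul M \<otimes> Ide C ?A \<otimes> mul N \<otimes> Ide C ?B) \<cdot>
        mid_swap C (?A \<odot> ?A) (?B \<odot> ?B) ?A ?B) \<cdot> (?s \<otimes> Ide C (?A \<odot> ?B))"
    by (subst mid_swap_natural[of _ "?A \<odot> ?A" ?A _ "?B \<odot> ?B" ?B _ ?A ?A _ ?B ?B]) (auto intro!: HomI)
  also have "\<dots> = ((mul M \<otimes> mul N) \<cdot> ((mul M \<otimes> Ide C ?A) \<otimes> (mul N \<otimes> Ide C ?B))) \<cdot>
        mid_swap C (?A \<odot> ?A) (?B \<odot> ?B) ?A ?B \<cdot> (?s \<otimes> Ide C (?A \<odot> ?B))"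
    by simp
  \<comment> \<open>Without \<open>TenA_assoc\<close> the two groups stay separate, and
    \<open>interchange\<close> reduces the equation to associativity of \<open>M\<close> and of
    \<open>N\<close>.\<close>
  also have "(mul M \<otimes> mul N) \<cdot> ((mul M \<otimes> Ide C ?A) \<otimes> (mul N \<otimes> Ide C ?B)) =
      (mul M \<otimes> mul N) \<cdot> ((Ide C ?A \<otimes> mul M) \<otimes> (Ide C ?B \<otimes> mul N))"
    by (subst (1 2) interchange) (simp_all add: is_monoidD del: TenA_assoc)
  also have "mid_swap C (?A \<odot> ?A) (?B \<odot> ?B) ?A ?B \<cdot> (?s \<otimes> Ide C (?A \<odot> ?B)) =
      mid_swap C ?A ?B (?A \<odot> ?A) (?B \<odot> ?B) \<cdot> (Ide C (?A \<odot> ?B) \<otimes> ?s)"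
    by (rule mid_swap_lax_assoc) simp_all
  also have "((mul M \<otimes> mul N) \<cdot> ((Ide C ?A \<otimes> mul M) \<otimes> (Ide C ?B \<otimes> mul N))) \<cdot> \<dots> =
      (mul M \<otimes> mul N) \<cdot> ((Ide C ?A \<otimes> mul M \<otimes> Ide C ?B \<otimes> mul N) \<cdot>
        mid_swap C ?A ?B (?A \<odot> ?A) (?B \<odot> ?B)) \<cdot> (Ide C (?A \<odot> ?B) \<otimes> ?s)"
    by simp
  also have "\<dots> = (mul M \<otimes> mul N) \<cdot> (mid_swap C ?A ?B ?A ?B \<cdot>
        (Ide C ?A \<otimes> Ide C ?B \<otimes> mul M \<otimes> mul N)) \<cdot> (Ide C (?A \<odot> ?B) \<otimes> ?s)"
    by (subst mid_swap_natural[of _ ?A ?A _ ?B ?B _ "?A \<odot> ?A" ?A _ "?B \<odot> ?B" ?B])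
      (auto intro!: HomI)
  also have "\<dots> = mul (mon_tensor C M N) \<cdot> (Ide C (?A \<odot> ?B) \<otimes> mul (mon_tensor C M N))"
    by (simp add: Ide_TenA_Cmp TenA_Ide[symmetric])
  finally have assoc: "mul (mon_tensor C M N) \<cdot> (mul (mon_tensor C M N) \<otimes> Ide C (?A \<odot> ?B)) =
    mul (mon_tensor C M N) \<cdot> (Ide C (?A \<odot> ?B) \<otimes> mul (mon_tensor C M N))" .
  have "mul (mon_tensor C M N) \<cdot> (uni (mon_tensor C M N) \<otimes> Ide C (?A \<odot> ?B)) =
      (mul M \<otimes> mul N) \<cdot> ?s \<cdot> (uni M \<otimes> uni N \<otimes> Ide C ?A \<otimes> Ide C ?B)"
    by (simp add: TenA_Ide)
  \<comment> \<open>Moving the units past \<open>?s\<close> turns it into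
    \<open>mid_swap C \<one> \<one> ?A ?B\<close>, an identity.\<close>
  also have "\<dots> = (mul M \<otimes> mul N) \<cdot> ((uni M \<otimes> Ide C ?A) \<otimes> (uni N \<otimes> Ide C ?B))"
    by (subst mid_swap_natural[of _ \<one> ?A _ \<one> ?B _ ?A ?A _ ?B ?B]) (auto intro!: HomI)
  also have "\<dots> = Ide C (?A \<odot> ?B)"
    by (subst interchange) (simp_all add: is_monoidD TenA_Ide del: TenA_assoc)
  finally have unit_left: "mul (mon_tensor C M N) \<cdot> (uni (mon_tensor C M N) \<otimes> Ide C (?A \<odot> ?B)) =
    Ide C (?A \<odot> ?B)" .
  have "mul (mon_tensor C M N) \<cdot> (Ide C (?A \<odot> ?B) \<otimes> uni (mon_tensor C M N)) =
      (mul M \<otimes> mul N) \<cdot> ?s \<cdot> (Ide C ?A \<otimes> Ide C ?B \<otimes> uni M \<otimes> uni N)"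
    by (simp add: TenA_Ide[symmetric])
  also have "\<dots> = (mul M \<otimes> mul N) \<cdot> ((Ide C ?A \<otimes> uni M) \<otimes> (Ide C ?B \<otimes> uni N))"
    by (subst mid_swap_natural[of _ ?A ?A _ ?B ?B _ \<one> ?A _ \<one> ?B]) (auto intro!: HomI)
  also have "\<dots> = Ide C (?A \<odot> ?B)"
    by (subst interchange) (simp_all add: is_monoidD TenA_Ide del: TenA_assoc)
  finally have unit_right: "mul (mon_tensor C M N) \<cdot> (Ide C (?A \<odot> ?B) \<otimes> uni (mon_tensor C M N)) =
    Ide C (?A \<odot> ?B)" .
  show ?thesis
    unfolding is_monoid_def
    using assoc unit_left unit_right by (auto intro!: HomI)
qed

lemma is_monoid_hom_Ide: "is_monoid C M \<Longrightarrow> is_monoid_hom C (MonArr M M (Ide C (carr M)))"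
  by (rule is_monoid_homI) (simp_all add: TenA_Ide)

lemma is_monoid_hom_Cmp:
  assumes [simp]: "is_monoid_hom C f" "is_monoid_hom C g" and e: "src g = tgt f"
  shows "is_monoid_hom C (MonArr (src f) (tgt g) (und g \<cdot> und f))"
proof (rule is_monoid_homI)
  \<comment> \<open>Rewriting \<open>src g\<close> to \<open>tgt f\<close> makes the facts about the
    two morphisms refer to the same middle monoid.\<close>
  note [simp] = is_monoid_hom_simps[OF assms(2), unfolded e]
  note g = is_monoid_homD[OF assms(2), unfolded e]
  have "(und g \<cdot> und f) \<cdot> mul (src f) = (und g \<cdot> mul (tgt f)) \<cdot> (und f \<otimes> und f)"
    by (simp add: is_monoid_homD)
  also have "\<dots> = mul (tgt g) \<cdot> ((und g \<cdot> und f) \<otimes> (und g \<cdot> und f))"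
    by (simp add: g interchange)
  finally show "(und g \<cdot> und f) \<cdot> mul (src f) = mul (tgt g) \<cdot> ((und g \<cdot> und f) \<otimes> (und g \<cdot> und f))" .
  show "(und g \<cdot> und f) \<cdot> uni (src f) = uni (tgt g)"
    by (simp add: is_monoid_homD g)
qed (use e in simp_all)

text \<open>Multiplicativity of \<open>f\<close> and \<open>g\<close> moves the arrows past the
  products, and naturality of \<open>mid_swap\<close> moves them past the exchange.\<close>

lemma is_monoid_hom_TenA:
  assumes [simp]: "is_monoid_hom C f" "is_monoid_hom C g"
  shows "is_monoid_hom C
    (MonArr (mon_tensor C (src f) (src g)) (mon_tensor C (tgt f) (tgt g)) (und f \<otimes> und g))"
proof (rule is_monoid_homI)
  let ?A = "carr (src f)" and ?B = "carr (src g)" and ?A' = "carr (tgt f)" and ?B' = "carr (tgt g)"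
  have "(und f \<otimes> und g) \<cdot> mul (mon_tensor C (src f) (src g)) =
      ((und f \<otimes> und g) \<cdot> (mul (src f) \<otimes> mul (src g))) \<cdot> mid_swap C ?A ?B ?A ?B"
    by simp
  also have "(und f \<otimes> und g) \<cdot> (mul (src f) \<otimes> mul (src g)) =
      (mul (tgt f) \<otimes> mul (tgt g)) \<cdot> ((und f \<otimes> und f) \<otimes> (und g \<otimes> und g))"
    by (subst (1 2) interchange) (simp_all add: is_monoid_homD)
  also have "\<dots> \<cdot> mid_swap C ?A ?B ?A ?B = (mul (tgt f) \<otimes> mul (tgt g)) \<cdot>
      ((und f \<otimes> und f \<otimes> und g \<otimes> und g) \<cdot> mid_swap C ?A ?B ?A ?B)"
    by simp
  also have "\<dots> = (mul (tgt f) \<otimes> mul (tgt g)) \<cdot>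
      (mid_swap C ?A' ?B' ?A' ?B' \<cdot> (und f \<otimes> und g \<otimes> und f \<otimes> und g))"
    by (subst mid_swap_natural[of _ ?A ?A' _ ?B ?B' _ ?A ?A' _ ?B ?B']) (auto intro!: HomI)
  also have "\<dots> = mul (mon_tensor C (tgt f) (tgt g)) \<cdot> ((und f \<otimes> und g) \<otimes> (und f \<otimes> und g))"
    by simp
  finally show "(und f \<otimes> und g) \<cdot> mul (mon_tensor C (src f) (src g)) =
    mul (mon_tensor C (tgt f) (tgt g)) \<cdot> ((und f \<otimes> und g) \<otimes> (und f \<otimes> und g))" .
qed (simp_all add: is_monoid_mon_tensor interchange is_monoid_homD)

text \<open>Naturality of \<open>\<sigma>\<close> moves it past the two products, and
  \<open>mid_swap_Sym\<close> past the exchange. For the units, naturality leaves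
  \<open>\<sigma> \<one> \<one>\<close>, an identity.\<close>

lemma is_monoid_hom_Sym:
  assumes [simp]: "is_monoid C M" "is_monoid C N"
  shows "is_monoid_hom C (MonArr (mon_tensor C M N) (mon_tensor C N M) (\<sigma> (carr M) (carr N)))"
proof (rule is_monoid_homI)
  let ?A = "carr M" and ?B = "carr N"
  have "\<sigma> ?A ?B \<cdot> mul (mon_tensor C M N) = (\<sigma> ?A ?B \<cdot> (mul M \<otimes> mul N)) \<cdot> mid_swap C ?A ?B ?A ?B"
    by simp
  also have "\<sigma> ?A ?B \<cdot> (mul M \<otimes> mul N) = (mul N \<otimes> mul M) \<cdot> \<sigma> (?A \<odot> ?A) (?B \<odot> ?B)"
    by (rule Sym_natural) (auto intro!: HomI)
  also have "\<dots> \<cdot> mid_swap C ?A ?B ?A ?B =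
      (mul N \<otimes> mul M) \<cdot> \<sigma> (?A \<odot> ?A) (?B \<odot> ?B) \<cdot> mid_swap C ?A ?B ?A ?B"
    by simp
  also have "\<sigma> (?A \<odot> ?A) (?B \<odot> ?B) \<cdot> mid_swap C ?A ?B ?A ?B =
      mid_swap C ?B ?A ?B ?A \<cdot> (\<sigma> ?A ?B \<otimes> \<sigma> ?A ?B)"
    by (rule mid_swap_Sym) simp_all
  finally show "\<sigma> ?A ?B \<cdot> mul (mon_tensor C M N) = mul (mon_tensor C N M) \<cdot> (\<sigma> ?A ?B \<otimes> \<sigma> ?A ?B)"
    by simp
  have "\<sigma> ?A ?B \<cdot> (uni M \<otimes> uni N) = (uni N \<otimes> uni M) \<cdot> \<sigma> \<one> \<one>"
    by (rule Sym_natural) (auto intro!: HomI)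
  then show "\<sigma> ?A ?B \<cdot> uni (mon_tensor C M N) = uni (mon_tensor C N M)"
    by simp
qed (simp_all add: is_monoid_mon_tensor)

text \<open>Carriers and units agree by strictness; the products agree because of
  \<open>mid_swap_assoc\<close>.\<close>

lemma mon_tensor_assoc:
  assumes [simp]: "is_monoid C M" "is_monoid C N" "is_monoid C P"
  shows "mon_tensor C (mon_tensor C M N) P = mon_tensor C M (mon_tensor C N P)"
proof (rule mon.expand, intro conjI)
  let ?A = "carr M" and ?B = "carr N" and ?D = "carr P"
  \<comment> \<open>The identity after \<open>mul P\<close> is inserted so that
    \<open>interchange[symmetric]\<close> can pull all three products out to the left.\<close>
  have "mul (mon_tensor C (mon_tensor C M N) P) =
      (((mul M \<otimes> mul N) \<cdot> mid_swap C ?A ?B ?A ?B) \<otimes> (mul P \<cdot> Ide C (?D \<odot> ?D))) \<cdot>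
        mid_swap C (?A \<odot> ?B) ?D (?A \<odot> ?B) ?D"
    by simp
  also have "\<dots> = (mul M \<otimes> mul N \<otimes> mul P) \<cdot> (mid_swap C ?A ?B ?A ?B \<otimes> Ide C (?D \<odot> ?D)) \<cdot>
        mid_swap C (?A \<odot> ?B) ?D (?A \<odot> ?B) ?D"
    by (subst interchange[symmetric]) simp_all
  also have "(mid_swap C ?A ?B ?A ?B \<otimes> Ide C (?D \<odot> ?D)) \<cdot> mid_swap C (?A \<odot> ?B) ?D (?A \<odot> ?B) ?D =
      (Ide C (?A \<odot> ?A) \<otimes> mid_swap C ?B ?D ?B ?D) \<cdot> mid_swap C ?A (?B \<odot> ?D) ?A (?B \<odot> ?D)"
    by (rule mid_swap_assoc) simp_all
  also have "(mul M \<otimes> mul N \<otimes> mul P) \<cdot> \<dots> =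
      ((mul M \<cdot> Ide C (?A \<odot> ?A)) \<otimes> ((mul N \<otimes> mul P) \<cdot> mid_swap C ?B ?D ?B ?D)) \<cdot>
        mid_swap C ?A (?B \<odot> ?D) ?A (?B \<odot> ?D)"
    by (subst interchange[symmetric]) simp_all
  also have "\<dots> = mul (mon_tensor C M (mon_tensor C N P))"
    by simp
  finally show "mul (mon_tensor C (mon_tensor C M N) P) = mul (mon_tensor C M (mon_tensor C N P))" .
qed simp_all

lemma mon_tensor_Unit:
  assumes "is_monoid C M"
  shows "mon_tensor C (Mon \<one> (Ide C \<one>) (Ide C \<one>)) M = M"
    "mon_tensor C M (Mon \<one> (Ide C \<one>) (Ide C \<one>)) = M"
  using assms by (auto intro!: mon.expand)

text \<open>A morphism of monoids is determined by its endpoints and its underlying arrow. Once the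
  structure maps are known to be monoid maps and the endpoints to agree strictly, each axiom is the
  one for \<open>C\<close>.\<close>

theorem strict_symmetric_monoidal_category_MON: "strict_symmetric_monoidal_category (MON C)"
proof unfold_locales
qed (auto simp: Hom_MON_iff is_monoid_Unit is_monoid_mon_tensor is_monoid_hom_Ide is_monoid_hom_Cmp
    is_monoid_hom_TenA is_monoid_hom_Sym mon_tensor_assoc mon_tensor_Unit
    interchange TenA_Ide Sym_inverse Sym_hexagon
    Sym_natural[OF HomI HomI] intro!: mon_arr.expand)

end

section \<open>The induced functor on monoids\<close>

lemma mon_image_simps [simp]:
  "carr (mon_image D F l \<kappa> M) = FO F (carr M)"
  "mul (mon_image D F l \<kappa> M) = FA F (mul M) \<cdot>\<^bsub>D\<^esub> l (carr M) (carr M)"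
  "uni (mon_image D F l \<kappa> M) = FA F (uni M) \<cdot>\<^bsub>D\<^esub> \<kappa>"
  by (simp_all add: mon_image_def)

lemma mon_functor_simps [simp]:
  "FO (mon_functor D F l \<kappa>) M = mon_image D F l \<kappa> M"
  "FA (mon_functor D F l \<kappa>) f =
    MonArr (mon_image D F l \<kappa> (src f)) (mon_image D F l \<kappa> (tgt f)) (FA F (und f))"
  by (simp_all add: mon_functor_def)

context cat_functor
begin

lemma FA_simps [simp]:
  assumes "f \<in> Ar C"
  shows "FA F f \<in> Ar D" "Dom D (FA F f) = FO F (Dom C f)" "Cod D (FA F f) = FO F (Cod C f)"
  using HomD[OF FA_Hom[OF HomI[OF assms refl refl]]] by auto

lemmas functor_simps [simp] = FO_Ob FA_Ide

lemma FA_Cmp':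
  assumes "f \<in> Ar C" "g \<in> Ar C" "Dom C g = Cod C f"
  shows "FA F (g \<cdot>\<^bsub>C\<^esub> f) = FA F g \<cdot>\<^bsub>D\<^esub> FA F f"
  using assms by (intro FA_Cmp) (auto intro!: HomI)

end

section \<open>Lax monoidal functors preserve monoids\<close>

context lax_monoidal_structure
begin

lemma lax_simps [simp]:
  assumes "X \<in> Ob C" "Y \<in> Ob C"
  shows "l X Y \<in> Ar D" "Dom D (l X Y) = FO F X \<odot>\<^bsub>D\<^esub> FO F Y" "Cod D (l X Y) = FO F (X \<odot>\<^bsub>C\<^esub> Y)"
  using HomD[OF lax_Hom[OF assms]] by auto

lemma unit_simps [simp]: "\<kappa> \<in> Ar D" "Dom D \<kappa> = \<one>\<^bsub>D\<^esub>" "Cod D \<kappa> = FO F \<one>\<^bsub>C\<^esub>"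
  using HomD[OF unit_Hom] by auto

text \<open>The tensor \<open>\<kappa> \<otimes> \<kappa>\<close> is
  \<open>\<kappa> \<otimes> id\<close> after \<open>\<kappa>\<close>, so the left unit law applies.
  Both the unit condition for \<open>l\<close> and the product condition for \<open>\<kappa>\<close>
  as monoid maps rest on this.\<close>

lemma lax_unit_unit: "l \<one>\<^bsub>C\<^esub> \<one>\<^bsub>C\<^esub> \<cdot>\<^bsub>D\<^esub> (\<kappa> \<otimes>\<^bsub>D\<^esub> \<kappa>) = \<kappa>"
proof -
  have "l \<one>\<^bsub>C\<^esub> \<one>\<^bsub>C\<^esub> \<cdot>\<^bsub>D\<^esub> (\<kappa> \<otimes>\<^bsub>D\<^esub> \<kappa>) = l \<one>\<^bsub>C\<^esub> \<one>\<^bsub>C\<^esub> \<cdot>\<^bsub>D\<^esub> (\<kappa> \<otimes>\<^bsub>D\<^esub> Ide D (FO F \<one>\<^bsub>C\<^esub>)) \<cdot>\<^bsub>D\<^esub> (Ide D \<one>\<^bsub>D\<^esub> \<otimes>\<^bsub>D\<^esub> \<kappa>)"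
    by (subst D.interchange_whisker) simp_all
  also have "\<dots> = (l \<one>\<^bsub>C\<^esub> \<one>\<^bsub>C\<^esub> \<cdot>\<^bsub>D\<^esub> (\<kappa> \<otimes>\<^bsub>D\<^esub> Ide D (FO F \<one>\<^bsub>C\<^esub>))) \<cdot>\<^bsub>D\<^esub> \<kappa>"
    by simp
  also have "\<dots> = \<kappa>"
    by (subst lax_unit_left) simp_all
  finally show ?thesis .
qed

text \<open>Two applications of associativity regroup a fourfold product so that the middle factors
  are combined first, which is where a symmetry can act.\<close>

lemma lax_middle:
  assumes [simp]: "X \<in> Ob C" "Y \<in> Ob C" "Z \<in> Ob C" "W \<in> Ob C"
  shows "l (X \<odot>\<^bsub>C\<^esub> Y) (Z \<odot>\<^bsub>C\<^esub> W) \<cdot>\<^bsub>D\<^esub> (l X Y \<otimes>\<^bsub>D\<^esub> l Z W) =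
    l X (Y \<odot>\<^bsub>C\<^esub> Z \<odot>\<^bsub>C\<^esub> W) \<cdot>\<^bsub>D\<^esub> (Ide D (FO F X) \<otimes>\<^bsub>D\<^esub> (l (Y \<odot>\<^bsub>C\<^esub> Z) W \<cdot>\<^bsub>D\<^esub> (l Y Z \<otimes>\<^bsub>D\<^esub> Ide D (FO F W))))"
proof -
  have "l (X \<odot>\<^bsub>C\<^esub> Y) (Z \<odot>\<^bsub>C\<^esub> W) \<cdot>\<^bsub>D\<^esub> (l X Y \<otimes>\<^bsub>D\<^esub> l Z W) = (l (X \<odot>\<^bsub>C\<^esub> Y) (Z \<odot>\<^bsub>C\<^esub> W) \<cdot>\<^bsub>D\<^esub>
      (l X Y \<otimes>\<^bsub>D\<^esub> Ide D (FO F (Z \<odot>\<^bsub>C\<^esub> W)))) \<cdot>\<^bsub>D\<^esub> (Ide D (FO F X \<odot>\<^bsub>D\<^esub> FO F Y) \<otimes>\<^bsub>D\<^esub> l Z W)"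
    by (simp add: D.interchange_whisker)
  also have "l (X \<odot>\<^bsub>C\<^esub> Y) (Z \<odot>\<^bsub>C\<^esub> W) \<cdot>\<^bsub>D\<^esub> (l X Y \<otimes>\<^bsub>D\<^esub> Ide D (FO F (Z \<odot>\<^bsub>C\<^esub> W))) =
      l X (Y \<odot>\<^bsub>C\<^esub> Z \<odot>\<^bsub>C\<^esub> W) \<cdot>\<^bsub>D\<^esub> (Ide D (FO F X) \<otimes>\<^bsub>D\<^esub> l Y (Z \<odot>\<^bsub>C\<^esub> W))"
    by (rule lax_assoc) simp_all
  also have "\<dots> \<cdot>\<^bsub>D\<^esub> (Ide D (FO F X \<odot>\<^bsub>D\<^esub> FO F Y) \<otimes>\<^bsub>D\<^esub> l Z W) = l X (Y \<odot>\<^bsub>C\<^esub> Z \<odot>\<^bsub>C\<^esub> W) \<cdot>\<^bsub>D\<^esub>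
      (Ide D (FO F X) \<otimes>\<^bsub>D\<^esub> (l Y (Z \<odot>\<^bsub>C\<^esub> W) \<cdot>\<^bsub>D\<^esub> (Ide D (FO F Y) \<otimes>\<^bsub>D\<^esub> l Z W)))"
    by (simp add: D.Ide_TenA_Cmp D.TenA_Ide[symmetric])
  finally show ?thesis by (simp add: lax_assoc)
qed

text \<open>Naturality of \<open>l\<close> collects the images of the structure arrows of
  \<open>M\<close> on the left; what remains is a law of \<open>M\<close> under \<open>F\<close>
  next to the corresponding law of \<open>l\<close>.\<close>

lemma is_monoid_mon_image:
  assumes [simp]: "is_monoid C M"
  shows "is_monoid D (mon_image D F l \<kappa> M)"
proof -
  let ?A = "carr M" and ?N = "mon_image D F l \<kappa> M"
  \<comment> \<open>The identity of \<open>FO F ?A\<close> is written as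
    \<open>FA F (Ide C ?A)\<close> so that naturality of \<open>l\<close> applies.\<close>
  have "mul ?N \<cdot>\<^bsub>D\<^esub> (mul ?N \<otimes>\<^bsub>D\<^esub> Ide D (FO F ?A)) = FA F (mul M) \<cdot>\<^bsub>D\<^esub>
      (l ?A ?A \<cdot>\<^bsub>D\<^esub> (FA F (mul M) \<otimes>\<^bsub>D\<^esub> FA F (Ide C ?A))) \<cdot>\<^bsub>D\<^esub> (l ?A ?A \<otimes>\<^bsub>D\<^esub> Ide D (FO F ?A))"
    by (simp add: D.Cmp_TenA_Ide)
  also have "l ?A ?A \<cdot>\<^bsub>D\<^esub> (FA F (mul M) \<otimes>\<^bsub>D\<^esub> FA F (Ide C ?A)) =
      FA F (mul M \<otimes>\<^bsub>C\<^esub> Ide C ?A) \<cdot>\<^bsub>D\<^esub> l (?A \<odot>\<^bsub>C\<^esub> ?A) ?A"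
    by (rule lax_natural) (auto intro!: HomI)
  also have "FA F (mul M) \<cdot>\<^bsub>D\<^esub> \<dots> \<cdot>\<^bsub>D\<^esub> (l ?A ?A \<otimes>\<^bsub>D\<^esub> Ide D (FO F ?A)) =
      FA F (mul M \<cdot>\<^bsub>C\<^esub> (mul M \<otimes>\<^bsub>C\<^esub> Ide C ?A)) \<cdot>\<^bsub>D\<^esub>
        (l (?A \<odot>\<^bsub>C\<^esub> ?A) ?A \<cdot>\<^bsub>D\<^esub> (l ?A ?A \<otimes>\<^bsub>D\<^esub> Ide D (FO F ?A)))"
    by (simp add: FA_Cmp')
  also have "\<dots> = FA F (mul M \<cdot>\<^bsub>C\<^esub> (Ide C ?A \<otimes>\<^bsub>C\<^esub> mul M)) \<cdot>\<^bsub>D\<^esub>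
        (l ?A (?A \<odot>\<^bsub>C\<^esub> ?A) \<cdot>\<^bsub>D\<^esub> (Ide D (FO F ?A) \<otimes>\<^bsub>D\<^esub> l ?A ?A))"
    by (simp only: lax_assoc is_monoidD is_monoid_simps assms)
  also have "\<dots> = FA F (mul M) \<cdot>\<^bsub>D\<^esub> (FA F (Ide C ?A \<otimes>\<^bsub>C\<^esub> mul M) \<cdot>\<^bsub>D\<^esub> l ?A (?A \<odot>\<^bsub>C\<^esub> ?A)) \<cdot>\<^bsub>D\<^esub>
      (Ide D (FO F ?A) \<otimes>\<^bsub>D\<^esub> l ?A ?A)"
    by (simp add: FA_Cmp')
  also have "FA F (Ide C ?A \<otimes>\<^bsub>C\<^esub> mul M) \<cdot>\<^bsub>D\<^esub> l ?A (?A \<odot>\<^bsub>C\<^esub> ?A) =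
      l ?A ?A \<cdot>\<^bsub>D\<^esub> (FA F (Ide C ?A) \<otimes>\<^bsub>D\<^esub> FA F (mul M))"
    by (rule lax_natural[symmetric]) (auto intro!: HomI)
  also have "FA F (mul M) \<cdot>\<^bsub>D\<^esub> \<dots> \<cdot>\<^bsub>D\<^esub> (Ide D (FO F ?A) \<otimes>\<^bsub>D\<^esub> l ?A ?A) =
      mul ?N \<cdot>\<^bsub>D\<^esub> (Ide D (FO F ?A) \<otimes>\<^bsub>D\<^esub> mul ?N)"
    by (simp add: D.Ide_TenA_Cmp)
  finally have assoc: "mul ?N \<cdot>\<^bsub>D\<^esub> (mul ?N \<otimes>\<^bsub>D\<^esub> Ide D (FO F ?A)) = mul ?N \<cdot>\<^bsub>D\<^esub> (Ide D (FO F ?A) \<otimes>\<^bsub>D\<^esub> mul ?N)" .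
  have "mul ?N \<cdot>\<^bsub>D\<^esub> (uni ?N \<otimes>\<^bsub>D\<^esub> Ide D (FO F ?A)) = FA F (mul M) \<cdot>\<^bsub>D\<^esub>
      (l ?A ?A \<cdot>\<^bsub>D\<^esub> (FA F (uni M) \<otimes>\<^bsub>D\<^esub> FA F (Ide C ?A))) \<cdot>\<^bsub>D\<^esub> (\<kappa> \<otimes>\<^bsub>D\<^esub> Ide D (FO F ?A))"
    by (simp add: D.Cmp_TenA_Ide)
  also have "l ?A ?A \<cdot>\<^bsub>D\<^esub> (FA F (uni M) \<otimes>\<^bsub>D\<^esub> FA F (Ide C ?A)) = FA F (uni M \<otimes>\<^bsub>C\<^esub> Ide C ?A) \<cdot>\<^bsub>D\<^esub> l \<one>\<^bsub>C\<^esub> ?A"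
    by (rule lax_natural) (auto intro!: HomI)
  also have "FA F (mul M) \<cdot>\<^bsub>D\<^esub> \<dots> \<cdot>\<^bsub>D\<^esub> (\<kappa> \<otimes>\<^bsub>D\<^esub> Ide D (FO F ?A)) =
      FA F (mul M \<cdot>\<^bsub>C\<^esub> (uni M \<otimes>\<^bsub>C\<^esub> Ide C ?A)) \<cdot>\<^bsub>D\<^esub> (l \<one>\<^bsub>C\<^esub> ?A \<cdot>\<^bsub>D\<^esub> (\<kappa> \<otimes>\<^bsub>D\<^esub> Ide D (FO F ?A)))"
    by (simp add: FA_Cmp')
  also have "\<dots> = Ide D (FO F ?A)"
    by (simp add: is_monoidD lax_unit_left)
  finally have unit_left: "mul ?N \<cdot>\<^bsub>D\<^esub> (uni ?N \<otimes>\<^bsub>D\<^esub> Ide D (FO F ?A)) = Ide D (FO F ?A)" .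
  have "mul ?N \<cdot>\<^bsub>D\<^esub> (Ide D (FO F ?A) \<otimes>\<^bsub>D\<^esub> uni ?N) = FA F (mul M) \<cdot>\<^bsub>D\<^esub>
      (l ?A ?A \<cdot>\<^bsub>D\<^esub> (FA F (Ide C ?A) \<otimes>\<^bsub>D\<^esub> FA F (uni M))) \<cdot>\<^bsub>D\<^esub> (Ide D (FO F ?A) \<otimes>\<^bsub>D\<^esub> \<kappa>)"
    by (simp add: D.Ide_TenA_Cmp)
  also have "l ?A ?A \<cdot>\<^bsub>D\<^esub> (FA F (Ide C ?A) \<otimes>\<^bsub>D\<^esub> FA F (uni M)) = FA F (Ide C ?A \<otimes>\<^bsub>C\<^esub> uni M) \<cdot>\<^bsub>D\<^esub> l ?A \<one>\<^bsub>C\<^esub>"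
    by (rule lax_natural) (auto intro!: HomI)
  also have "FA F (mul M) \<cdot>\<^bsub>D\<^esub> \<dots> \<cdot>\<^bsub>D\<^esub> (Ide D (FO F ?A) \<otimes>\<^bsub>D\<^esub> \<kappa>) =
      FA F (mul M \<cdot>\<^bsub>C\<^esub> (Ide C ?A \<otimes>\<^bsub>C\<^esub> uni M)) \<cdot>\<^bsub>D\<^esub> (l ?A \<one>\<^bsub>C\<^esub> \<cdot>\<^bsub>D\<^esub> (Ide D (FO F ?A) \<otimes>\<^bsub>D\<^esub> \<kappa>))"
    by (simp add: FA_Cmp')
  also have "\<dots> = Ide D (FO F ?A)"
    by (simp add: is_monoidD lax_unit_right)
  finally have unit_right: "mul ?N \<cdot>\<^bsub>D\<^esub> (Ide D (FO F ?A) \<otimes>\<^bsub>D\<^esub> uni ?N) = Ide D (FO F ?A)" .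
  show ?thesis
    unfolding is_monoid_def
    using assoc unit_left unit_right by (auto intro!: HomI)
qed

lemma is_monoid_hom_mon_functor:
  assumes [simp]: "is_monoid_hom C f"
  shows "is_monoid_hom D (FA (mon_functor D F l \<kappa>) f)"
  unfolding mon_functor_simps
proof (rule is_monoid_homI)
  let ?A = "carr (src f)" and ?B = "carr (tgt f)"
  have "FA F (und f) \<cdot>\<^bsub>D\<^esub> mul (mon_image D F l \<kappa> (src f)) = FA F (und f \<cdot>\<^bsub>C\<^esub> mul (src f)) \<cdot>\<^bsub>D\<^esub> l ?A ?A"
    by (simp add: FA_Cmp')
  also have "\<dots> = FA F (mul (tgt f)) \<cdot>\<^bsub>D\<^esub> (FA F (und f \<otimes>\<^bsub>C\<^esub> und f) \<cdot>\<^bsub>D\<^esub> l ?A ?A)"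
    by (simp add: is_monoid_homD FA_Cmp')
  also have "FA F (und f \<otimes>\<^bsub>C\<^esub> und f) \<cdot>\<^bsub>D\<^esub> l ?A ?A = l ?B ?B \<cdot>\<^bsub>D\<^esub> (FA F (und f) \<otimes>\<^bsub>D\<^esub> FA F (und f))"
    by (rule lax_natural[symmetric]) (auto intro!: HomI)
  finally show "FA F (und f) \<cdot>\<^bsub>D\<^esub> mul (mon_image D F l \<kappa> (src f)) =
      mul (mon_image D F l \<kappa> (tgt f)) \<cdot>\<^bsub>D\<^esub> (FA F (und f) \<otimes>\<^bsub>D\<^esub> FA F (und f))"
    by simp
  have "FA F (und f) \<cdot>\<^bsub>D\<^esub> uni (mon_image D F l \<kappa> (src f)) = FA F (und f \<cdot>\<^bsub>C\<^esub> uni (src f)) \<cdot>\<^bsub>D\<^esub> \<kappa>"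
    by (simp add: FA_Cmp')
  then show "FA F (und f) \<cdot>\<^bsub>D\<^esub> uni (mon_image D F l \<kappa> (src f)) = uni (mon_image D F l \<kappa> (tgt f))"
    by (simp add: is_monoid_homD)
qed (simp_all add: is_monoid_mon_image)

end

section \<open>Symmetry of the lax structure and its lift to monoids\<close>

context symmetric_lax_monoidal_structure
begin

text \<open>By \<open>lax_middle\<close> the factors to be exchanged are multiplied first. There
  \<open>lax_symmetric\<close> turns the symmetry of \<open>D\<close> into the image of that of
  \<open>C\<close>, and naturality of \<open>l\<close> carries this image to the outside.\<close>

lemma lax_mid_swap:
  assumes [simp]: "X \<in> Ob C" "Y \<in> Ob C" "X' \<in> Ob C" "Y' \<in> Ob C"
  shows "l (X \<odot>\<^bsub>C\<^esub> X') (Y \<odot>\<^bsub>C\<^esub> Y') \<cdot>\<^bsub>D\<^esub> (l X X' \<otimes>\<^bsub>D\<^esub> l Y Y') \<cdot>\<^bsub>D\<^esub>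
      mid_swap D (FO F X) (FO F Y) (FO F X') (FO F Y') =
    FA F (mid_swap C X Y X' Y') \<cdot>\<^bsub>D\<^esub> l (X \<odot>\<^bsub>C\<^esub> Y) (X' \<odot>\<^bsub>C\<^esub> Y') \<cdot>\<^bsub>D\<^esub> (l X Y \<otimes>\<^bsub>D\<^esub> l X' Y')"
proof -
  let ?IX = "Ide D (FO F X)" and ?IY' = "Ide D (FO F Y')"
  \<comment> \<open>The part without \<open>X\<close>: symmetry of \<open>l\<close> on the pair
    \<open>Y\<close>, \<open>X'\<close>, then naturality in the first argument.\<close>
  have inner: "(l (X' \<odot>\<^bsub>C\<^esub> Y) Y' \<cdot>\<^bsub>D\<^esub> (l X' Y \<otimes>\<^bsub>D\<^esub> ?IY')) \<cdot>\<^bsub>D\<^esub> (\<sigma>\<^bsub>D\<^esub> (FO F Y) (FO F X') \<otimes>\<^bsub>D\<^esub> ?IY') =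
    FA F (\<sigma>\<^bsub>C\<^esub> Y X' \<otimes>\<^bsub>C\<^esub> Ide C Y') \<cdot>\<^bsub>D\<^esub> l (Y \<odot>\<^bsub>C\<^esub> X') Y' \<cdot>\<^bsub>D\<^esub> (l Y X' \<otimes>\<^bsub>D\<^esub> ?IY')"
  proof -
    have "(l (X' \<odot>\<^bsub>C\<^esub> Y) Y' \<cdot>\<^bsub>D\<^esub> (l X' Y \<otimes>\<^bsub>D\<^esub> ?IY')) \<cdot>\<^bsub>D\<^esub> (\<sigma>\<^bsub>D\<^esub> (FO F Y) (FO F X') \<otimes>\<^bsub>D\<^esub> ?IY') =
      l (X' \<odot>\<^bsub>C\<^esub> Y) Y' \<cdot>\<^bsub>D\<^esub> ((l X' Y \<cdot>\<^bsub>D\<^esub> \<sigma>\<^bsub>D\<^esub> (FO F Y) (FO F X')) \<otimes>\<^bsub>D\<^esub> ?IY')"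
      by (simp add: D.Cmp_TenA_Ide)
    also have "\<dots> = (l (X' \<odot>\<^bsub>C\<^esub> Y) Y' \<cdot>\<^bsub>D\<^esub> (FA F (\<sigma>\<^bsub>C\<^esub> Y X') \<otimes>\<^bsub>D\<^esub> FA F (Ide C Y'))) \<cdot>\<^bsub>D\<^esub> (l Y X' \<otimes>\<^bsub>D\<^esub> ?IY')"
      by (simp add: lax_symmetric[symmetric] D.Cmp_TenA_Ide)
    also have "l (X' \<odot>\<^bsub>C\<^esub> Y) Y' \<cdot>\<^bsub>D\<^esub> (FA F (\<sigma>\<^bsub>C\<^esub> Y X') \<otimes>\<^bsub>D\<^esub> FA F (Ide C Y')) =
        FA F (\<sigma>\<^bsub>C\<^esub> Y X' \<otimes>\<^bsub>C\<^esub> Ide C Y') \<cdot>\<^bsub>D\<^esub> l (Y \<odot>\<^bsub>C\<^esub> X') Y'"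
      by (rule lax_natural) (auto intro!: HomI)
    finally show ?thesis by simp
  qed
  have "l (X \<odot>\<^bsub>C\<^esub> X') (Y \<odot>\<^bsub>C\<^esub> Y') \<cdot>\<^bsub>D\<^esub> (l X X' \<otimes>\<^bsub>D\<^esub> l Y Y') \<cdot>\<^bsub>D\<^esub>
      mid_swap D (FO F X) (FO F Y) (FO F X') (FO F Y') =
    (l (X \<odot>\<^bsub>C\<^esub> X') (Y \<odot>\<^bsub>C\<^esub> Y') \<cdot>\<^bsub>D\<^esub> (l X X' \<otimes>\<^bsub>D\<^esub> l Y Y')) \<cdot>\<^bsub>D\<^esub>
      mid_swap D (FO F X) (FO F Y) (FO F X') (FO F Y')"
    by simp
  also have "\<dots> = l X (X' \<odot>\<^bsub>C\<^esub> Y \<odot>\<^bsub>C\<^esub> Y') \<cdot>\<^bsub>D\<^esub> (?IX \<otimes>\<^bsub>D\<^esub>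
      ((l (X' \<odot>\<^bsub>C\<^esub> Y) Y' \<cdot>\<^bsub>D\<^esub> (l X' Y \<otimes>\<^bsub>D\<^esub> ?IY')) \<cdot>\<^bsub>D\<^esub> (\<sigma>\<^bsub>D\<^esub> (FO F Y) (FO F X') \<otimes>\<^bsub>D\<^esub> ?IY')))"
    by (simp add: lax_middle mid_swap_def D.Ide_TenA_Cmp)
  also have "\<dots> = (l X (X' \<odot>\<^bsub>C\<^esub> Y \<odot>\<^bsub>C\<^esub> Y') \<cdot>\<^bsub>D\<^esub> (FA F (Ide C X) \<otimes>\<^bsub>D\<^esub> FA F (\<sigma>\<^bsub>C\<^esub> Y X' \<otimes>\<^bsub>C\<^esub> Ide C Y'))) \<cdot>\<^bsub>D\<^esub>
      (?IX \<otimes>\<^bsub>D\<^esub> (l (Y \<odot>\<^bsub>C\<^esub> X') Y' \<cdot>\<^bsub>D\<^esub> (l Y X' \<otimes>\<^bsub>D\<^esub> ?IY')))"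
    unfolding inner by (simp add: D.Ide_TenA_Cmp)
  also have "l X (X' \<odot>\<^bsub>C\<^esub> Y \<odot>\<^bsub>C\<^esub> Y') \<cdot>\<^bsub>D\<^esub> (FA F (Ide C X) \<otimes>\<^bsub>D\<^esub> FA F (\<sigma>\<^bsub>C\<^esub> Y X' \<otimes>\<^bsub>C\<^esub> Ide C Y')) =
      FA F (mid_swap C X Y X' Y') \<cdot>\<^bsub>D\<^esub> l X (Y \<odot>\<^bsub>C\<^esub> X' \<odot>\<^bsub>C\<^esub> Y')"
    unfolding mid_swap_def by (rule lax_natural) (auto intro!: HomI)
  also have "\<dots> \<cdot>\<^bsub>D\<^esub> (?IX \<otimes>\<^bsub>D\<^esub> (l (Y \<odot>\<^bsub>C\<^esub> X') Y' \<cdot>\<^bsub>D\<^esub> (l Y X' \<otimes>\<^bsub>D\<^esub> ?IY'))) =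
      FA F (mid_swap C X Y X' Y') \<cdot>\<^bsub>D\<^esub> l (X \<odot>\<^bsub>C\<^esub> Y) (X' \<odot>\<^bsub>C\<^esub> Y') \<cdot>\<^bsub>D\<^esub> (l X Y \<otimes>\<^bsub>D\<^esub> l X' Y')"
    by (simp add: lax_middle)
  finally show ?thesis .
qed

text \<open>After naturality of \<open>l\<close> has moved the images of the products to the left,
  the product condition is \<open>lax_mid_swap\<close> at the carriers \<open>A\<close>,
  \<open>B\<close>, \<open>A\<close>, \<open>B\<close>.\<close>

lemma is_monoid_hom_mon_lax:
  assumes [simp]: "is_monoid C M" "is_monoid C N"
  shows "is_monoid_hom D (mon_lax C D F l \<kappa> M N)"
  unfolding mon_lax_def
proof (rule is_monoid_homI)
  let ?A = "carr M" and ?B = "carr N"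
  let ?FM = "mon_image D F l \<kappa> M" and ?FN = "mon_image D F l \<kappa> N"
  let ?s = "mid_swap D (FO F ?A) (FO F ?B) (FO F ?A) (FO F ?B)"
  have "l ?A ?B \<cdot>\<^bsub>D\<^esub> mul (mon_tensor D ?FM ?FN) = (l ?A ?B \<cdot>\<^bsub>D\<^esub> (FA F (mul M) \<otimes>\<^bsub>D\<^esub> FA F (mul N))) \<cdot>\<^bsub>D\<^esub>
      (l ?A ?A \<otimes>\<^bsub>D\<^esub> l ?B ?B) \<cdot>\<^bsub>D\<^esub> ?s"
    by (simp add: D.interchange[symmetric])
  also have "l ?A ?B \<cdot>\<^bsub>D\<^esub> (FA F (mul M) \<otimes>\<^bsub>D\<^esub> FA F (mul N)) =
      FA F (mul M \<otimes>\<^bsub>C\<^esub> mul N) \<cdot>\<^bsub>D\<^esub> l (?A \<odot>\<^bsub>C\<^esub> ?A) (?B \<odot>\<^bsub>C\<^esub> ?B)"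
    by (rule lax_natural) (auto intro!: HomI)
  also have "\<dots> \<cdot>\<^bsub>D\<^esub> (l ?A ?A \<otimes>\<^bsub>D\<^esub> l ?B ?B) \<cdot>\<^bsub>D\<^esub> ?s =
      FA F (mul M \<otimes>\<^bsub>C\<^esub> mul N) \<cdot>\<^bsub>D\<^esub> (l (?A \<odot>\<^bsub>C\<^esub> ?A) (?B \<odot>\<^bsub>C\<^esub> ?B) \<cdot>\<^bsub>D\<^esub> (l ?A ?A \<otimes>\<^bsub>D\<^esub> l ?B ?B) \<cdot>\<^bsub>D\<^esub> ?s)"
    by simp
  also have "l (?A \<odot>\<^bsub>C\<^esub> ?A) (?B \<odot>\<^bsub>C\<^esub> ?B) \<cdot>\<^bsub>D\<^esub> (l ?A ?A \<otimes>\<^bsub>D\<^esub> l ?B ?B) \<cdot>\<^bsub>D\<^esub> ?s =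
      FA F (mid_swap C ?A ?B ?A ?B) \<cdot>\<^bsub>D\<^esub> l (?A \<odot>\<^bsub>C\<^esub> ?B) (?A \<odot>\<^bsub>C\<^esub> ?B) \<cdot>\<^bsub>D\<^esub> (l ?A ?B \<otimes>\<^bsub>D\<^esub> l ?A ?B)"
    by (rule lax_mid_swap) simp_all
  also have "FA F (mul M \<otimes>\<^bsub>C\<^esub> mul N) \<cdot>\<^bsub>D\<^esub> \<dots> =
      mul (mon_image D F l \<kappa> (mon_tensor C M N)) \<cdot>\<^bsub>D\<^esub> (l ?A ?B \<otimes>\<^bsub>D\<^esub> l ?A ?B)"
    by (simp add: FA_Cmp')
  finally show "l ?A ?B \<cdot>\<^bsub>D\<^esub> mul (mon_tensor D ?FM ?FN) =
      mul (mon_image D F l \<kappa> (mon_tensor C M N)) \<cdot>\<^bsub>D\<^esub> (l ?A ?B \<otimes>\<^bsub>D\<^esub> l ?A ?B)" .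
  have "l ?A ?B \<cdot>\<^bsub>D\<^esub> uni (mon_tensor D ?FM ?FN) =
      (l ?A ?B \<cdot>\<^bsub>D\<^esub> (FA F (uni M) \<otimes>\<^bsub>D\<^esub> FA F (uni N))) \<cdot>\<^bsub>D\<^esub> (\<kappa> \<otimes>\<^bsub>D\<^esub> \<kappa>)"
    by (simp add: D.interchange[symmetric])
  also have "l ?A ?B \<cdot>\<^bsub>D\<^esub> (FA F (uni M) \<otimes>\<^bsub>D\<^esub> FA F (uni N)) = FA F (uni M \<otimes>\<^bsub>C\<^esub> uni N) \<cdot>\<^bsub>D\<^esub> l \<one>\<^bsub>C\<^esub> \<one>\<^bsub>C\<^esub>"
    by (rule lax_natural) (auto intro!: HomI)
  finally show "l ?A ?B \<cdot>\<^bsub>D\<^esub> uni (mon_tensor D ?FM ?FN) =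
      uni (mon_image D F l \<kappa> (mon_tensor C M N))"
    by (simp add: lax_unit_unit)
qed (simp_all add: C.is_monoid_mon_tensor D.is_monoid_mon_tensor is_monoid_mon_image)

lemma is_monoid_hom_mon_lax_unit: "is_monoid_hom D (mon_lax_unit C D F l \<kappa>)"
  unfolding mon_lax_unit_def MON_simps
  by (rule is_monoid_homI)
    (simp_all add: C.is_monoid_Unit D.is_monoid_Unit is_monoid_mon_image lax_unit_unit)

lemma cat_functor_MON: "cat_functor (MON C) (MON D) (mon_functor D F l \<kappa>)"
proof -
  interpret MC: strict_symmetric_monoidal_category "MON C"
    by (rule C.strict_symmetric_monoidal_category_MON)
  interpret MD: strict_symmetric_monoidal_category "MON D"
    by (rule D.strict_symmetric_monoidal_category_MON)
  show ?thesis
    by unfold_locales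
      (use is_monoid_hom_mon_functor in
        \<open>auto simp: Hom_MON_iff is_monoid_mon_image FA_Cmp'\<close>)
qed

text \<open>Symmetry of \<open>l\<close> enters through \<open>homs\<close>, which makes the
  components arrows of \<open>MON D\<close>. The equations are those of \<open>l\<close> and
  \<open>\<kappa>\<close> on underlying arrows.\<close>

theorem lax_monoidal_structure_MON:
  "lax_monoidal_structure (MON C) (MON D) (mon_functor D F l \<kappa>)
    (mon_lax C D F l \<kappa>) (mon_lax_unit C D F l \<kappa>)"
proof -
  interpret MC: strict_symmetric_monoidal_category "MON C"
    by (rule C.strict_symmetric_monoidal_category_MON)
  interpret MD: strict_symmetric_monoidal_category "MON D"
    by (rule D.strict_symmetric_monoidal_category_MON)
  interpret MF: cat_functor "MON C" "MON D" "mon_functor D F l \<kappa>"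
    by (rule cat_functor_MON)
  note homs = is_monoid_hom_mon_lax is_monoid_hom_mon_lax_unit
  note [simp] = C.mon_tensor_assoc D.mon_tensor_assoc C.mon_tensor_Unit D.mon_tensor_Unit
    is_monoid_mon_image
  show ?thesis
    by unfold_locales
      (use homs in \<open>auto simp: Hom_MON_iff mon_lax_def mon_lax_unit_def lax_assoc lax_unit_left
        lax_unit_right lax_natural[OF HomI HomI] intro!: mon_arr.expand\<close>)
qed

end

section \<open>Lifting the colax structure\<close>

text \<open>The arguments \<open>l\<close> and \<open>\<kappa>\<close> determine the monoid
  structures at the two ends; the arrow itself comes from \<open>c\<close>.\<close>

definition mon_colax ::
    "('o1, 'a1, 'm1) sym_mon_cat_scheme \<Rightarrow> ('o2, 'a2, 'm2) sym_mon_cat_scheme \<Rightarrow>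
     ('o1, 'a1, 'o2, 'a2) cat_map \<Rightarrow> ('o1 \<Rightarrow> 'o1 \<Rightarrow> 'a2) \<Rightarrow> 'a2 \<Rightarrow> ('o1 \<Rightarrow> 'o1 \<Rightarrow> 'a2) \<Rightarrow>
     ('o1, 'a1) mon \<Rightarrow> ('o1, 'a1) mon \<Rightarrow> ('o2, 'a2) mon_arr" where
  "mon_colax C D F l \<kappa> c M N =
     MonArr (mon_image D F l \<kappa> (mon_tensor C M N))
       (mon_tensor D (mon_image D F l \<kappa> M) (mon_image D F l \<kappa> N))
       (c (carr M) (carr N))"

definition mon_counit ::
    "('o1, 'a1, 'm1) sym_mon_cat_scheme \<Rightarrow> ('o2, 'a2, 'm2) sym_mon_cat_scheme \<Rightarrow>
     ('o1, 'a1, 'o2, 'a2) cat_map \<Rightarrow> ('o1 \<Rightarrow> 'o1 \<Rightarrow> 'a2) \<Rightarrow> 'a2 \<Rightarrow> 'a2 \<Rightarrow> ('o2, 'a2) mon_arr" where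
  "mon_counit C D F l \<kappa> \<alpha> = MonArr (mon_image D F l \<kappa> \<one>\<^bsub>MON C\<^esub>) \<one>\<^bsub>MON D\<^esub> \<alpha>"

context colax_monoidal_structure
begin

lemma colax_simps [simp]:
  assumes "X \<in> Ob C" "Y \<in> Ob C"
  shows "c X Y \<in> Ar D" "Dom D (c X Y) = FO F (X \<odot>\<^bsub>C\<^esub> Y)" "Cod D (c X Y) = FO F X \<odot>\<^bsub>D\<^esub> FO F Y"
  using HomD[OF colax_Hom[OF assms]] by auto

lemma counit_simps [simp]: "\<alpha> \<in> Ar D" "Dom D \<alpha> = FO F \<one>\<^bsub>C\<^esub>" "Cod D \<alpha> = \<one>\<^bsub>D\<^esub>"
  using HomD[OF counit_Hom] by auto

end

section \<open>Colax structure maps as monoid maps\<close>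

context bialgebra_axiom
begin

lemma is_monoid_hom_mon_colax:
  assumes unit: "bialgebra_unit_axiom C D c \<alpha> l \<kappa>"
    and [simp]: "is_monoid C M" "is_monoid C N"
  shows "is_monoid_hom D (mon_colax C D F l \<kappa> c M N)"
  unfolding mon_colax_def
proof (rule is_monoid_homI)
  let ?A = "carr M" and ?B = "carr N"
  let ?FM = "mon_image D F l \<kappa> M" and ?FN = "mon_image D F l \<kappa> N"
  let ?s = "mid_swap D (FO F ?A) (FO F ?B) (FO F ?A) (FO F ?B)"
  have "c ?A ?B \<cdot>\<^bsub>D\<^esub> mul (mon_image D F l \<kappa> (mon_tensor C M N)) =
      (c ?A ?B \<cdot>\<^bsub>D\<^esub> FA F (mul M \<otimes>\<^bsub>C\<^esub> mul N)) \<cdot>\<^bsub>D\<^esub>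
        FA F (mid_swap C ?A ?B ?A ?B) \<cdot>\<^bsub>D\<^esub> l (?A \<odot>\<^bsub>C\<^esub> ?B) (?A \<odot>\<^bsub>C\<^esub> ?B)"
    by (simp add: FA_Cmp')
  also have "c ?A ?B \<cdot>\<^bsub>D\<^esub> FA F (mul M \<otimes>\<^bsub>C\<^esub> mul N) =
      (FA F (mul M) \<otimes>\<^bsub>D\<^esub> FA F (mul N)) \<cdot>\<^bsub>D\<^esub> c (?A \<odot>\<^bsub>C\<^esub> ?A) (?B \<odot>\<^bsub>C\<^esub> ?B)"
    by (rule colax_natural) (auto intro!: HomI)
  also have "\<dots> \<cdot>\<^bsub>D\<^esub> FA F (mid_swap C ?A ?B ?A ?B) \<cdot>\<^bsub>D\<^esub> l (?A \<odot>\<^bsub>C\<^esub> ?B) (?A \<odot>\<^bsub>C\<^esub> ?B) =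
      (FA F (mul M) \<otimes>\<^bsub>D\<^esub> FA F (mul N)) \<cdot>\<^bsub>D\<^esub> (c (?A \<odot>\<^bsub>C\<^esub> ?A) (?B \<odot>\<^bsub>C\<^esub> ?B) \<cdot>\<^bsub>D\<^esub>
        FA F (mid_swap C ?A ?B ?A ?B) \<cdot>\<^bsub>D\<^esub> l (?A \<odot>\<^bsub>C\<^esub> ?B) (?A \<odot>\<^bsub>C\<^esub> ?B))"
    by simp
  \<comment> \<open>The bialgebra axiom at \<open>?A\<close>, \<open>?B\<close>, \<open>?A\<close>,
    \<open>?B\<close>: the product of the tensor monoid contains exactly this exchange of middle
    factors.\<close>
  also have "c (?A \<odot>\<^bsub>C\<^esub> ?A) (?B \<odot>\<^bsub>C\<^esub> ?B) \<cdot>\<^bsub>D\<^esub> FA F (mid_swap C ?A ?B ?A ?B) \<cdot>\<^bsub>D\<^esub> l (?A \<odot>\<^bsub>C\<^esub> ?B) (?A \<odot>\<^bsub>C\<^esub> ?B) =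
      (l ?A ?A \<otimes>\<^bsub>D\<^esub> l ?B ?B) \<cdot>\<^bsub>D\<^esub> ?s \<cdot>\<^bsub>D\<^esub> (c ?A ?B \<otimes>\<^bsub>D\<^esub> c ?A ?B)"
    by (rule bialgebra) simp_all
  also have "(FA F (mul M) \<otimes>\<^bsub>D\<^esub> FA F (mul N)) \<cdot>\<^bsub>D\<^esub> \<dots> =
      mul (mon_tensor D ?FM ?FN) \<cdot>\<^bsub>D\<^esub> (c ?A ?B \<otimes>\<^bsub>D\<^esub> c ?A ?B)"
    by (simp add: D.interchange[symmetric])
  finally show "c ?A ?B \<cdot>\<^bsub>D\<^esub> mul (mon_image D F l \<kappa> (mon_tensor C M N)) =
      mul (mon_tensor D ?FM ?FN) \<cdot>\<^bsub>D\<^esub> (c ?A ?B \<otimes>\<^bsub>D\<^esub> c ?A ?B)" .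
  have "c ?A ?B \<cdot>\<^bsub>D\<^esub> uni (mon_image D F l \<kappa> (mon_tensor C M N)) =
      (c ?A ?B \<cdot>\<^bsub>D\<^esub> FA F (uni M \<otimes>\<^bsub>C\<^esub> uni N)) \<cdot>\<^bsub>D\<^esub> \<kappa>"
    by simp
  \<comment> \<open>Naturality along the units of \<open>M\<close> and \<open>N\<close> reduces the
    unit condition to the case of \<open>c \<one> \<one>\<close>, the first clause of the unit
    axiom.\<close>
  also have "c ?A ?B \<cdot>\<^bsub>D\<^esub> FA F (uni M \<otimes>\<^bsub>C\<^esub> uni N) = (FA F (uni M) \<otimes>\<^bsub>D\<^esub> FA F (uni N)) \<cdot>\<^bsub>D\<^esub> c \<one>\<^bsub>C\<^esub> \<one>\<^bsub>C\<^esub>"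
    by (rule colax_natural) (auto intro!: HomI)
  also have "\<dots> \<cdot>\<^bsub>D\<^esub> \<kappa> = (FA F (uni M) \<otimes>\<^bsub>D\<^esub> FA F (uni N)) \<cdot>\<^bsub>D\<^esub> (c \<one>\<^bsub>C\<^esub> \<one>\<^bsub>C\<^esub> \<cdot>\<^bsub>D\<^esub> \<kappa>)"
    by simp
  also have "c \<one>\<^bsub>C\<^esub> \<one>\<^bsub>C\<^esub> \<cdot>\<^bsub>D\<^esub> \<kappa> = \<kappa> \<otimes>\<^bsub>D\<^esub> \<kappa>"
    using unit by (simp add: bialgebra_unit_axiom_def)
  also have "(FA F (uni M) \<otimes>\<^bsub>D\<^esub> FA F (uni N)) \<cdot>\<^bsub>D\<^esub> \<dots> = uni (mon_tensor D ?FM ?FN)"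
    by (simp add: D.interchange)
  finally show "c ?A ?B \<cdot>\<^bsub>D\<^esub> uni (mon_image D F l \<kappa> (mon_tensor C M N)) =
      uni (mon_tensor D ?FM ?FN)" .
qed (simp_all add: C.is_monoid_mon_tensor D.is_monoid_mon_tensor is_monoid_mon_image)

text \<open>The unit monoid has identities as product and unit, so the second and third clauses of
  \<open>bialgebra_unit_axiom\<close> are the two conditions on a monoid map.\<close>

lemma is_monoid_hom_mon_counit:
  assumes "bialgebra_unit_axiom C D c \<alpha> l \<kappa>"
  shows "is_monoid_hom D (mon_counit C D F l \<kappa> \<alpha>)"
  unfolding mon_counit_def MON_simps
  by (rule is_monoid_homI)
    (use assms in \<open>simp_all add: C.is_monoid_Unit D.is_monoid_Unit is_monoid_mon_image
      bialgebra_unit_axiom_def\<close>)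

text \<open>The functor on monoids is an assumption here; \<open>cat_functor_MON\<close>, proved for
  symmetric lax structures, supplies it at the end.\<close>

theorem colax_monoidal_structure_MON:
  assumes "cat_functor (MON C) (MON D) (mon_functor D F l \<kappa>)"
    and "bialgebra_unit_axiom C D c \<alpha> l \<kappa>"
  shows "colax_monoidal_structure (MON C) (MON D) (mon_functor D F l \<kappa>)
    (mon_colax C D F l \<kappa> c) (mon_counit C D F l \<kappa> \<alpha>)"
proof -
  interpret MC: strict_symmetric_monoidal_category "MON C"
    by (rule C.strict_symmetric_monoidal_category_MON)
  interpret MD: strict_symmetric_monoidal_category "MON D"
    by (rule D.strict_symmetric_monoidal_category_MON)
  interpret MF: cat_functor "MON C" "MON D" "mon_functor D F l \<kappa>"
    by (rule assms)
  note homs = is_monoid_hom_mon_colax[OF assms(2)] is_monoid_hom_mon_counit[OF assms(2)]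
  note [simp] = C.mon_tensor_assoc D.mon_tensor_assoc C.mon_tensor_Unit D.mon_tensor_Unit
    is_monoid_mon_image
  show ?thesis
    by unfold_locales
      (use homs in \<open>auto simp: Hom_MON_iff mon_colax_def mon_counit_def colax_coassoc
        colax_counit_left colax_counit_right colax_natural[OF HomI HomI] intro!: mon_arr.expand\<close>)
qed

theorem bialgebra_axiom_MON:
  assumes "lax_monoidal_structure (MON C) (MON D) (mon_functor D F l \<kappa>)
      (mon_lax C D F l \<kappa>) (mon_lax_unit C D F l \<kappa>)"
    and "bialgebra_unit_axiom C D c \<alpha> l \<kappa>"
  shows "bialgebra_axiom (MON C) (MON D) (mon_functor D F l \<kappa>)
    (mon_colax C D F l \<kappa> c) (mon_counit C D F l \<kappa> \<alpha>)
    (mon_lax C D F l \<kappa>) (mon_lax_unit C D F l \<kappa>)"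
proof -
  interpret MC: strict_symmetric_monoidal_category "MON C"
    by (rule C.strict_symmetric_monoidal_category_MON)
  interpret MD: strict_symmetric_monoidal_category "MON D"
    by (rule D.strict_symmetric_monoidal_category_MON)
  interpret MF: lax_monoidal_structure "MON C" "MON D" "mon_functor D F l \<kappa>"
    "mon_lax C D F l \<kappa>" "mon_lax_unit C D F l \<kappa>"
    by (rule assms)
  interpret MG: colax_monoidal_structure "MON C" "MON D" "mon_functor D F l \<kappa>"
    "mon_colax C D F l \<kappa> c" "mon_counit C D F l \<kappa> \<alpha>"
    by (rule colax_monoidal_structure_MON[OF MF.cat_functor_axioms assms(2)])
  show ?thesis
    \<comment> \<open>Composition in \<open>MON D\<close> keeps only the outer endpoints, which
      agree on both sides; the underlying equation is \<open>bialgebra\<close> at the four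
      carriers.\<close>
    by unfold_locales (simp add: mid_swap_MON mon_colax_def mon_lax_def bialgebra)
qed

text \<open>The underlying equations are the assumed ones; \<open>mon_tensor_Unit\<close> makes the
  endpoints agree, as the unit monoid tensored with itself is again the unit monoid.\<close>

lemma bialgebra_unit_axiom_MON:
  assumes "bialgebra_unit_axiom C D c \<alpha> l \<kappa>"
  shows "bialgebra_unit_axiom (MON C) (MON D) (mon_colax C D F l \<kappa> c) (mon_counit C D F l \<kappa> \<alpha>)
    (mon_lax C D F l \<kappa>) (mon_lax_unit C D F l \<kappa>)"
  using assms
  by (simp add: bialgebra_unit_axiom_def mon_colax_def mon_counit_def mon_lax_def mon_lax_unit_def
      C.mon_tensor_Unit D.mon_tensor_Unit C.is_monoid_Unit D.is_monoid_Unit)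

end

theorem lemma1p6:
  fixes C :: "('o1, 'a1) sym_mon_cat"
    and D :: "('o2, 'a2) sym_mon_cat"
    and F :: "('o1, 'a1, 'o2, 'a2) cat_map"
    and l c :: "'o1 \<Rightarrow> 'o1 \<Rightarrow> 'a2"
    and \<kappa> \<alpha> :: 'a2
  assumes "strict_symmetric_monoidal_category C"
    and "strict_symmetric_monoidal_category D"
    and "cat_functor C D F"
    and "symmetric_lax_monoidal_structure C D F l \<kappa>"
    and "colax_monoidal_structure C D F c \<alpha>"
    and "bialgebra_axiom C D F c \<alpha> l \<kappa>"
    and "bialgebra_unit_axiom C D c \<alpha> l \<kappa>"
  shows "\<exists>c_mon \<alpha>_mon.
      colax_monoidal_structure (MON C) (MON D) (mon_functor D F l \<kappa>) c_mon \<alpha>_mon \<and>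
      (\<forall>X \<in> Ob (MON C). \<forall>Y \<in> Ob (MON C). und (c_mon X Y) = c (carr X) (carr Y)) \<and>
      und \<alpha>_mon = \<alpha> \<and>
      bialgebra_axiom (MON C) (MON D) (mon_functor D F l \<kappa>) c_mon \<alpha>_mon
        (mon_lax C D F l \<kappa>) (mon_lax_unit C D F l \<kappa>) \<and>
      bialgebra_unit_axiom (MON C) (MON D) c_mon \<alpha>_mon
        (mon_lax C D F l \<kappa>) (mon_lax_unit C D F l \<kappa>)"
proof -
  \<comment> \<open>This interpretation provides the lifted functor and lax structure; the next one
    lifts \<open>c\<close> and \<open>\<alpha>\<close> over them.\<close>
  interpret symmetric_lax_monoidal_structure C D F l \<kappa> by (rule assms(4))
  interpret B: bialgebra_axiom C D F c \<alpha> l \<kappa> by (rule assms(6))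
  show ?thesis
    using B.colax_monoidal_structure_MON[OF cat_functor_MON assms(7)]
      B.bialgebra_axiom_MON[OF lax_monoidal_structure_MON assms(7)]
      B.bialgebra_unit_axiom_MON[OF assms(7)]
    by (intro exI[of _ "mon_colax C D F l \<kappa> c"] exI[of _ "mon_counit C D F l \<kappa> \<alpha>"])
      (simp add: mon_colax_def mon_counit_def)
qed

end
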